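(* Let $Q = I_1\times I_2\times I_3\subset\mathbb{R}^3$ be a closed rectangular box with each $I_j$ a bounded closed interval, let $T>0$, and let $\Omega_t\subset Q$ ($t\in[0,T)$) be a regular tube (defined by a function $\theta$ as in the context) that moves with a $C^1$ velocity field $u(x,t)=(u_1,u_2,u_3)$ defined on $Q\times[0,T)$ which is divergence free ($\nabla_x\cdot u = 0$ on $Q\times[0,T)$). If $$\int_0^T \sup_{x\in Q}|u(x,t)|\,dt<\infty,$$ then $$\liminf_{t\to T^-}\operatorname{Vol}(\Omega_t)>0.$$
   Context: Regular tube: Let $Q=I_1\times I_2\times I_3$ be a closed rectangular box ($I_j$ bounded closed intervals) and $T>0$. A regular tube is a family of open sets $\Omega_t\subset Q$, $t\in[0,T)$, of the form $\Omega_t=\{(x_1,x_2,x_3)\in Q:\theta(x_1,x_2,x_3,t)<0\}$, where $\theta\in C^1(Q\times[0,T))$ satisfies: (i) $|\nabla_{x_1,x_2}\theta|\neq 0$ at every $(x_1,x_2,x_3,t)\in Q\times[0,T)$ with $\theta(x_1,x_2,x_3,t)=0$; (ii) for every $x_3\in I_3$ and $t\in[0,T)$, the slice $\Omega_t(x_3):=\{(x_1,x_2)\in I_1\times I_2:(x_1,x_2,x_3)\in\Omega_t\}$ is non-empty; (iii) for every $x_3\in I_3$ and $t\in[0,T)$, the closure of $\Omega_t(x_3)$ is contained in the interior of $I_1\times I_2$. The tube moves with a velocity field $u$ (a $C^1$ field on $Q\times[0,T)$) if $\left(\frac{\partial}{\partial t}+u\cdot\nabla_x\right)\theta=0$ at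 every $(x,t)\in Q\times[0,T)$ with $\theta(x,t)=0$. *)

theory Defs
  imports "HOL-Analysis.Analysis"
begin

definition tube_set :: "((real^3) \<times> real \<Rightarrow> real) \<Rightarrow> (real^3) set \<Rightarrow> real \<Rightarrow> (real^3) set" where
  "tube_set \<theta> Q t = {x \<in> Q. \<theta> (x, t) < 0}"

definition tube_slice ::
  "((real^3) \<times> real \<Rightarrow> real) \<Rightarrow> real^3 \<Rightarrow> real^3 \<Rightarrow> real \<Rightarrow> real \<Rightarrow> (real \<times> real) set" where
  "tube_slice \<theta> a b t x3 =
     {(y1, y2). y1 \<in> {a$1..b$1} \<and> y2 \<in> {a$2..b$2} \<and> vector [y1, y2, x3] \<in> tube_set \<theta> (cbox a b) t}"

end

theory Submission
  imports Defs
begin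

text \<open>
  Choose \<open>t\<^sub>0\<close> so late that the integral of \<open>m(s) = sup |u(\<cdot>, s)|\<close> over \<open>[t\<^sub>0, T)\<close> is small compared with the
  height of \<open>Q\<close>, and follow the part of the tube in a horizontal slab around the middle of \<open>Q\<close> whose
  two faces move outwards with speed \<open>m\<close>. No fluid leaves this part, so by incompressibility its
  volume does not decrease, and the volume of the tube stays above the positive volume at \<open>t\<^sub>0\<close>.

  To avoid flow maps and surface integrals, the volume is replaced by
  \<open>F(s) = \<integral>\<^sub>Q cutoff (-\<theta>/\<epsilon>) \<psi> dx\<close> with \<open>\<psi>\<close> a weight on the slab. Differentiating
  under the integral and integrating by parts, \<open>F'\<close> is bounded below by minus the integral of
  \<open>\<psi> |(\<partial>\<^sub>t + u \<cdot> \<nabla>) \<theta>|\<close> over the layer \<open>-\<epsilon> < \<theta> < 0\<close> with density \<open>cutoff' (-\<theta>/\<epsilon>) / \<epsilon>\<close>. The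
  material derivative is small on the layer, and the total density of the layer is bounded because
  the horizontal gradient does not vanish on \<open>\<theta> = 0\<close>. Now let \<open>\<epsilon> \<rightarrow> 0\<close>.
\<close>

section \<open>Calculus of continuously differentiable functions on a set\<close>

text \<open>The derivative is taken within \<open>S\<close>, so faces of the box and end times are
  covered. Keeping \<open>f'\<close> a plain function of point and direction lets the derivatives of
  sums, products and compositions be written as terms; in finite dimension, continuity in every
  fixed direction is continuity of the derivative.\<close>

definition C1_on :: "'a::real_normed_vector set \<Rightarrow> ('a \<Rightarrow> real) \<Rightarrow> ('a \<Rightarrow> 'a \<Rightarrow> real) \<Rightarrow> bool" where
  "C1_on S f f' \<longleftrightarrow>
     (\<forall>p\<in>S. (f has_derivative f' p) (at p within S)) \<and> (\<forall>v. continuous_on S (\<lambda>p. f' p v))"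

lemma C1_on_derivative: "C1_on S f f' \<Longrightarrow> p \<in> S \<Longrightarrow> (f has_derivative f' p) (at p within S)"
  and C1_on_continuous_derivative: "C1_on S f f' \<Longrightarrow> continuous_on S (\<lambda>p. f' p v)"
  by (auto simp: C1_on_def)

lemma C1_on_continuous: "C1_on S f f' \<Longrightarrow> continuous_on S f"
  by (metis C1_on_def has_derivative_continuous_on)

lemma C1_on_subset: "C1_on S f f' \<Longrightarrow> A \<subseteq> S \<Longrightarrow> C1_on A f f'"
  unfolding C1_on_def by (meson continuous_on_subset has_derivative_subset subsetD)

lemma C1_on_const: "C1_on S (\<lambda>_. c) (\<lambda>_ _. 0)"
  by (auto simp: C1_on_def)

lemma C1_on_bounded_linear: "bounded_linear f \<Longrightarrow> C1_on S f (\<lambda>_. f)"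
  by (auto simp: C1_on_def bounded_linear_imp_has_derivative)

lemma C1_on_add:
  assumes "C1_on S f f'" "C1_on S g g'"
  shows "C1_on S (\<lambda>p. f p + g p) (\<lambda>p v. f' p v + g' p v)"
  using assms by (auto simp: C1_on_def intro!: has_derivative_add continuous_on_add)

lemma C1_on_mult:
  assumes "C1_on S f f'" "C1_on S g g'"
  shows "C1_on S (\<lambda>p. f p * g p) (\<lambda>p v. f p * g' p v + f' p v * g p)"
  using assms C1_on_continuous[OF assms(1)] C1_on_continuous[OF assms(2)]
  by (auto simp: C1_on_def intro!: has_derivative_mult continuous_intros)

lemma C1_on_compose:
  fixes \<phi> :: "real \<Rightarrow> real"
  assumes f: "C1_on S f f'" and \<phi>: "\<And>z. z \<in> f ` S \<Longrightarrow> (\<phi> has_real_derivative \<phi>' z) (at z within f ` S)"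
    and cont: "continuous_on (f ` S) \<phi>'"
  shows "C1_on S (\<lambda>p. \<phi> (f p)) (\<lambda>p v. \<phi>' (f p) * f' p v)"
  unfolding C1_on_def
proof (intro conjI ballI allI)
  fix p assume p: "p \<in> S"
  have "(\<phi> \<circ> f has_derivative (*) (\<phi>' (f p)) \<circ> f' p) (at p within S)"
    using C1_on_derivative[OF f p] \<phi>[of "f p"] p
    by (intro diff_chain_within) (auto simp: has_field_derivative_def)
  then show "((\<lambda>p. \<phi> (f p)) has_derivative (\<lambda>v. \<phi>' (f p) * f' p v)) (at p within S)"
    by (simp add: o_def)
next
  fix v
  show "continuous_on S (\<lambda>p. \<phi>' (f p) * f' p v)"
    using continuous_on_compose2[OF cont C1_on_continuous[OF f]] f
    by (auto simp: C1_on_def intro!: continuous_intros)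
qed

text \<open>Makes Stone-Weierstrass approximants of a merely continuous field admissible in the
  divergence theorem.\<close>

lemma real_polynomial_function_C1:
  fixes p :: "'a::euclidean_space \<Rightarrow> real"
  assumes "real_polynomial_function p"
  obtains p' where "C1_on UNIV p p'"
proof -
  have "\<exists>p'. C1_on UNIV p p'"
    using assms
  proof induction
    case (linear f) then show ?case using C1_on_bounded_linear by blast
  next
    case (const c) then show ?case using C1_on_const by blast
  next
    case (add f g) then show ?case using C1_on_add by blast
  next
    case (mult f g) then show ?case using C1_on_mult by blast
  qed
  then show thesis using that by blast
qed

lemma C1_on_spatial_derivative:
  assumes "C1_on (A \<times> J) f f'" "x \<in> A" "s \<in> J"
  shows "((\<lambda>x. f (x, s)) has_derivative (\<lambda>v. f' (x, s) (v, 0))) (at x within A)"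
proof -
  have "((\<lambda>x. (x, s)) has_derivative (\<lambda>v. (v, 0))) (at x within A)"
    by (auto intro!: derivative_eq_intros)
  moreover have "(f has_derivative f' (x, s)) (at (x, s) within (\<lambda>x. (x, s)) ` A)"
    using C1_on_derivative[OF assms(1), of "(x, s)"] assms by (auto intro: has_derivative_subset)
  ultimately show ?thesis
    using diff_chain_within[of "\<lambda>x. (x, s)" _ x A f "f' (x, s)"] by (simp add: o_def)
qed

lemma C1_on_time_derivative:
  assumes "C1_on (A \<times> J) f f'" "x \<in> A" "s \<in> J"
  shows "((\<lambda>s. f (x, s)) has_real_derivative f' (x, s) (0, 1)) (at s within J)"
proof -
  have "((\<lambda>s. (x, s)) has_derivative (\<lambda>v. (0, v))) (at s within J)"
    by (auto intro!: derivative_eq_intros)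
  moreover have D: "(f has_derivative f' (x, s)) (at (x, s) within (\<lambda>s. (x, s)) ` J)"
    using C1_on_derivative[OF assms(1), of "(x, s)"] assms by (auto intro: has_derivative_subset)
  ultimately have "((\<lambda>s. f (x, s)) has_derivative (\<lambda>v. f' (x, s) (0, v))) (at s within J)"
    using diff_chain_within[of "\<lambda>s. (x, s)" _ s J f "f' (x, s)"] by (simp add: o_def)
  moreover have "f' (x, s) (0, v) = f' (x, s) (0, 1) * v" for v
    using linear_cmul[OF has_derivative_linear[OF D], of v "(0, 1)"] by simp
  then have "(\<lambda>v. f' (x, s) (0, v)) = (*) (f' (x, s) (0, 1))"
    by (rule ext)
  ultimately show ?thesis
    unfolding has_field_derivative_def by metis
qed

lemma continuous_on_time_slice:
  "continuous_on (A \<times> J) f \<Longrightarrow> s \<in> J \<Longrightarrow> continuous_on A (\<lambda>x. f (x, s))"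
  by (erule continuous_on_compose2) (auto intro!: continuous_intros)

section \<open>A continuously differentiable cutoff\<close>

text \<open>Squaring the positive part removes its kink at 0. Both the cutoff of the tube and the
  weight of the slab are built from this function.\<close>

definition sqpos :: "real \<Rightarrow> real" where
  "sqpos z = (max 0 z)\<^sup>2"

text \<open>In all four sign cases of \<open>y\<close> and \<open>z\<close> the first order
  remainder is at most the square of \<open>y - z\<close>, so the difference quotient errs by at
  most \<open>\<bar>y - z\<bar>\<close>.\<close>

lemma sqpos_deriv: "(sqpos has_real_derivative 2 * max 0 z) (at z within S)"
  unfolding has_field_derivative_def
proof (rule has_derivativeI_sandwich[of 1])
  show "bounded_linear ((*) (2 * max 0 z))"
    by (rule bounded_linear_mult_right)
  show "((\<lambda>y. \<bar>y - z\<bar>) \<longlongrightarrow> 0) (at z within S)"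
    by (intro tendsto_rabs_zero LIM_zero tendsto_ident_at)
next
  fix y assume "y \<noteq> z"
  have "\<bar>sqpos y - sqpos z - 2 * max 0 z * (y - z)\<bar> \<le> (y - z)\<^sup>2"
  proof (cases "0 \<le> y"; cases "0 \<le> z")
    assume "0 \<le> y" "\<not> 0 \<le> z"
    then have "y\<^sup>2 \<le> (y - z)\<^sup>2" by (intro power_mono) auto
    then show ?thesis using \<open>0 \<le> y\<close> \<open>\<not> 0 \<le> z\<close> by (simp add: sqpos_def max_def)
  next
    assume y: "\<not> 0 \<le> y" and z: "0 \<le> z"
    have "sqpos y - sqpos z - 2 * max 0 z * (y - z) = (y - z)\<^sup>2 - y\<^sup>2"
      using y z by (simp add: sqpos_def max_def power2_eq_square algebra_simps)
    moreover have "y\<^sup>2 \<le> (y - z)\<^sup>2"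
      using y z by (simp add: power2_le_iff_abs_le abs_le_square_iff[symmetric])
    ultimately show ?thesis by simp
  next
    assume "0 \<le> y" "0 \<le> z"
    then have "sqpos y - sqpos z - 2 * max 0 z * (y - z) = (y - z)\<^sup>2"
      by (simp add: sqpos_def max_def power2_eq_square algebra_simps)
    then show ?thesis by simp
  qed (simp add: sqpos_def max_def)
  then show "norm (sqpos y - sqpos z - 2 * max 0 z * (y - z)) / norm (y - z) \<le> \<bar>y - z\<bar>"
    using \<open>y \<noteq> z\<close> by (simp add: divide_le_eq power2_eq_square[symmetric] flip: abs_mult)
qed simp

lemma sqpos_nonneg [simp]: "0 \<le> sqpos z"
  and sqpos_eq_0_iff [simp]: "sqpos z = 0 \<longleftrightarrow> z \<le> 0"
  and sqpos_mono: "y \<le> z \<Longrightarrow> sqpos y \<le> sqpos z"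
  by (auto simp: sqpos_def max_def intro: power_mono)

lemma sqpos_pos_iff [simp]: "0 < sqpos z \<longleftrightarrow> 0 < z"
  by (metis sqpos_nonneg sqpos_eq_0_iff not_less order_less_le)

text \<open>A nondecreasing step: 0 for \<open>z \<le> 0\<close>,
  \<open>1 - (1 - z\<^sup>2)\<^sup>2\<close> on the unit interval, 1 for \<open>z \<ge> 1\<close>.
  The slope \<open>4 * (1 - z\<^sup>2) * z\<close> vanishes at both ends, so the pieces fit together
  in a C^1 way.\<close>

definition cutoff :: "real \<Rightarrow> real" where
  "cutoff z = 1 - sqpos (1 - sqpos z)"

definition cutoff' :: "real \<Rightarrow> real" where
  "cutoff' z = 4 * max 0 (1 - sqpos z) * max 0 z"

lemma cutoff_deriv: "(cutoff has_real_derivative cutoff' z) (at z within S)"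
proof -
  have "((\<lambda>z. sqpos (1 - sqpos z)) has_real_derivative
      2 * max 0 (1 - sqpos z) * (0 - 2 * max 0 z)) (at z within S)"
    by (rule DERIV_chain2[OF sqpos_deriv]) (intro derivative_intros sqpos_deriv)
  from DERIV_diff[OF DERIV_const this, of 1] show ?thesis
    by (simp add: cutoff_def[abs_def] cutoff'_def mult.assoc)
qed

lemma continuous_on_sqpos: "continuous_on S sqpos"
  unfolding sqpos_def by (intro continuous_intros)

lemma continuous_on_cutoff': "continuous_on S cutoff'"
  unfolding cutoff'_def by (intro continuous_intros continuous_on_sqpos)

lemma cutoff_le_1: "cutoff z \<le> 1"
  and cutoff_mono: "y \<le> z \<Longrightarrow> cutoff y \<le> cutoff z"
  by (auto simp: cutoff_def intro!: sqpos_mono)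

lemma cutoff_nonpos [simp]: "z \<le> 0 \<Longrightarrow> cutoff z = 0"
  by (simp add: cutoff_def sqpos_def)

lemma cutoff_nonneg: "0 \<le> cutoff z"
  using cutoff_mono[of "min 0 z" z] by simp

lemma cutoff_pos: "0 < z \<Longrightarrow> 0 < cutoff z"
proof -
  assume "0 < z"
  then have "max 0 (1 - sqpos z) < 1" by (simp add: max_def)
  then have "(max 0 (1 - sqpos z))\<^sup>2 < 1\<^sup>2" by (intro power_strict_mono) auto
  then show ?thesis by (simp add: cutoff_def sqpos_def)
qed

lemma cutoff'_nonneg: "0 \<le> cutoff' z"
  by (simp add: cutoff'_def)

lemma cutoff'_eq_0: "z \<notin> {0<..<1} \<Longrightarrow> cutoff' z = 0"
proof -
  assume "z \<notin> {0<..<1}"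
  then consider "z \<le> 0" | "1 \<le> z" by fastforce
  then show ?thesis
  proof cases
    case 2
    then have "1 \<le> sqpos z" using sqpos_mono[of 1 z] by (simp add: sqpos_def)
    then show ?thesis by (simp add: cutoff'_def)
  qed (simp add: cutoff'_def)
qed

section \<open>The divergence theorem on a box, one coordinate at a time\<close>

text \<open>Extended by zero, \<open>g\<close> is Lipschitz along \<open>i\<close>; its difference quotients in that direction have
  integral zero by translation invariance and converge dominatedly.\<close>

lemma integral_partial_derivative_eq_0:
  fixes g :: "'a::euclidean_space \<Rightarrow> real" and D :: "'a \<Rightarrow> 'a \<Rightarrow> real"
  assumes i: "i \<in> Basis"
    and der: "\<And>x. x \<in> cbox a b \<Longrightarrow> (g has_derivative D x) (at x within cbox a b)"
    and cont: "continuous_on (cbox a b) (\<lambda>x. D x i)"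
    and zero: "\<And>x. x \<in> cbox a b \<Longrightarrow> x \<bullet> i = a \<bullet> i \<or> x \<bullet> i = b \<bullet> i \<Longrightarrow> g x = 0"
  shows "integral (cbox a b) (\<lambda>x. D x i) = 0"
proof -
  define G where "G x = indicator (cbox a b) x *\<^sub>R g x" for x
  have contg: "continuous_on (cbox a b) g"
    using der by (rule has_derivative_continuous_on)
  have line: "((\<lambda>h. g (x + h *\<^sub>R i)) has_real_derivative D (x + h *\<^sub>R i) i) (at h within S)"
    if "\<And>h. h \<in> S \<Longrightarrow> x + h *\<^sub>R i \<in> cbox a b" "h \<in> S" for x h S
  proof -
    have "((\<lambda>h. x + h *\<^sub>R i) has_derivative (\<lambda>k. k *\<^sub>R i)) (at h within S)"
      by (auto intro!: derivative_eq_intros)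
    moreover have Dd: "(g has_derivative D (x + h *\<^sub>R i)) (at (x + h *\<^sub>R i) within (\<lambda>h. x + h *\<^sub>R i) ` S)"
      using that by (intro has_derivative_subset[OF der]) auto
    ultimately have "((\<lambda>h. g (x + h *\<^sub>R i)) has_derivative (\<lambda>k. D (x + h *\<^sub>R i) (k *\<^sub>R i))) (at h within S)"
      using diff_chain_within[of "\<lambda>h. x + h *\<^sub>R i" _ h S g] by (simp add: o_def)
    moreover have "D (x + h *\<^sub>R i) (k *\<^sub>R i) = D (x + h *\<^sub>R i) i * k" for k
      using linear_cmul[OF has_derivative_linear[OF Dd], of k i] by simp
    ultimately show ?thesis
      by (simp add: has_field_derivative_def)
  qed
  obtain M where M: "\<And>x. x \<in> cbox a b \<Longrightarrow> \<bar>D x i\<bar> \<le> M" and M0: "0 \<le> M"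
  proof -
    have "bounded ((\<lambda>x. D x i) ` cbox a b)"
      using compact_continuous_image[OF cont compact_cbox] by (rule compact_imp_bounded)
    then obtain M where "\<And>x. x \<in> cbox a b \<Longrightarrow> \<bar>D x i\<bar> \<le> M"
      by (auto simp: bounded_iff)
    then have "\<And>x. x \<in> cbox a b \<Longrightarrow> \<bar>D x i\<bar> \<le> max 0 M"
      by fastforce
    then show thesis
      using that[of "max 0 M"] by simp
  qed
  have comp: "(x + h *\<^sub>R i) \<bullet> j = (if j = i then x \<bullet> i + h else x \<bullet> j)" if "j \<in> Basis" for x h j
    using that i by (auto simp: inner_add_left inner_Basis)
  have lip_in: "\<bar>g (x + h *\<^sub>R i) - g x\<bar> \<le> M * h"
    if x: "x \<in> cbox a b" and xh: "x + h *\<^sub>R i \<in> cbox a b" and h: "0 \<le> h" for x h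
  proof -
    have "x + k *\<^sub>R i \<in> cbox a b" if "k \<in> {0..h}" for k
      unfolding mem_box
    proof
      fix j :: 'a assume j: "j \<in> Basis"
      show "a \<bullet> j \<le> (x + k *\<^sub>R i) \<bullet> j \<and> (x + k *\<^sub>R i) \<bullet> j \<le> b \<bullet> j"
        using x xh j that unfolding mem_box by (force simp: comp)
    qed
    then have "norm (g (x + h *\<^sub>R i) - g (x + 0 *\<^sub>R i)) \<le> M * norm (h - 0)"
      using h by (intro field_differentiable_bound[of "{0..h}", OF _ line]) (auto intro!: M)
    then show ?thesis using h by simp
  qed
  \<comment> \<open>If exactly one end of the segment lies in the box, the segment crosses a face
    normal to \<open>i\<close>, where \<open>g\<close> vanishes. Comparing the inner end with the
    crossing point at parameter \<open>k\<close> gives the bound for the extension by zero.\<close>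
  have lip: "\<bar>G (x + h *\<^sub>R i) - G x\<bar> \<le> M * h" if h: "0 \<le> h" for x h
  proof (cases "x \<in> cbox a b"; cases "x + h *\<^sub>R i \<in> cbox a b")
    assume x: "x \<in> cbox a b" and n: "x + h *\<^sub>R i \<notin> cbox a b"
    define k where "k = b \<bullet> i - x \<bullet> i"
    have "x \<bullet> i + h > b \<bullet> i"
    proof (rule ccontr)
      assume "\<not> x \<bullet> i + h > b \<bullet> i"
      then have "x + h *\<^sub>R i \<in> cbox a b"
        using x h unfolding mem_box by (force simp: comp)
      then show False using n by blast
    qed
    then have k: "k \<le> h" "0 \<le> k" using x i by (auto simp: k_def mem_box)
    have y: "x + k *\<^sub>R i \<in> cbox a b" "(x + k *\<^sub>R i) \<bullet> i = b \<bullet> i"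
      using x k i unfolding mem_box k_def by (auto simp: comp)
    have "\<bar>g x\<bar> \<le> M * k"
      using lip_in[OF x y(1) k(2)] zero[OF y(1)] y(2) by simp
    also have "\<dots> \<le> M * h" using k M0 by (simp add: mult_left_mono)
    finally show ?thesis using x n by (simp add: G_def)
  next
    assume n: "x \<notin> cbox a b" and x: "x + h *\<^sub>R i \<in> cbox a b"
    define k where "k = a \<bullet> i - x \<bullet> i"
    have "x \<bullet> i < a \<bullet> i"
    proof (rule ccontr)
      assume c: "\<not> x \<bullet> i < a \<bullet> i"
      have "x \<in> cbox a b"
        unfolding mem_box
      proof
        fix j :: 'a assume j: "j \<in> Basis"
        show "a \<bullet> j \<le> x \<bullet> j \<and> x \<bullet> j \<le> b \<bullet> j"
          using x[unfolded mem_box, rule_format, OF j] c h by (auto simp: comp[OF j] split: if_splits)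
      qed
      then show False using n by blast
    qed
    moreover have "a \<bullet> i \<le> x \<bullet> i + h" "x \<bullet> i + h \<le> b \<bullet> i"
      using x[unfolded mem_box, rule_format, OF i] by (auto simp: comp[OF i])
    ultimately have k: "k \<le> h" "0 \<le> k" "a \<bullet> i \<le> b \<bullet> i" by (auto simp: k_def)
    have y: "x + k *\<^sub>R i \<in> cbox a b" "(x + k *\<^sub>R i) \<bullet> i = a \<bullet> i"
    proof -
      show "(x + k *\<^sub>R i) \<bullet> i = a \<bullet> i" using i by (simp add: comp k_def)
      show "x + k *\<^sub>R i \<in> cbox a b"
        unfolding mem_box
      proof
        fix j :: 'a assume j: "j \<in> Basis"
        show "a \<bullet> j \<le> (x + k *\<^sub>R i) \<bullet> j \<and> (x + k *\<^sub>R i) \<bullet> j \<le> b \<bullet> j"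
          using x[unfolded mem_box, rule_format, OF j] k by (auto simp: comp[OF j] k_def split: if_splits)
      qed
    qed
    have e: "x + k *\<^sub>R i + (h - k) *\<^sub>R i = x + h *\<^sub>R i" by (simp add: algebra_simps)
    have "\<bar>g (x + h *\<^sub>R i)\<bar> \<le> M * (h - k)"
      using lip_in[OF y(1), of "h - k", unfolded e] x k zero[OF y(1)] y(2) by simp
    also have "\<dots> \<le> M * h" using k M0 by (simp add: mult_left_mono)
    finally show ?thesis using x n by (simp add: G_def)
  qed (use lip_in M0 h in \<open>auto simp: G_def\<close>)
  have Gint: "integrable lborel G"
    unfolding G_def by (rule borel_integrable_compact[OF compact_cbox contg])
  then have Gm [measurable]: "G \<in> borel_measurable borel" by simp
  have Gint_shift: "integrable lborel (\<lambda>x. G (x + c))" and G_shift: "(\<integral>x. G (x + c) \<partial>lborel) = (\<integral>x. G x \<partial>lborel)" for c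
  proof -
    have "integrable (distr lborel borel ((+) c)) G"
      using Gint by (simp add: lborel_distr_plus)
    then show "integrable lborel (\<lambda>x. G (x + c))"
      by (subst (asm) integrable_distr_eq) (auto simp: add.commute)
    have "(\<integral>x. G x \<partial>lborel) = (\<integral>x. G x \<partial>(distr lborel borel ((+) c)))"
      by (simp add: lborel_distr_plus)
    also have "\<dots> = (\<integral>x. G (x + c) \<partial>lborel)"
      by (subst integral_distr) (auto simp: add.commute)
    finally show "(\<integral>x. G (x + c) \<partial>lborel) = (\<integral>x. G x \<partial>lborel)" by simp
  qed
  define h where "h n = inverse (real (Suc n))" for n
  have h: "0 < h n" "h n \<le> 1" for n by (auto simp: h_def inverse_le_1_iff)
  define s where "s n x = (G (x + h n *\<^sub>R i) - G x) / h n" for n x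
  define G' where "G' x = indicator (cbox a b) x *\<^sub>R D x i" for x
  have G'int: "integrable lborel G'"
    unfolding G'_def by (rule borel_integrable_compact[OF compact_cbox cont])
  have "(\<lambda>n. integral\<^sup>L lborel (s n)) \<longlonglongrightarrow> integral\<^sup>L lborel G'"
  proof (rule integral_dominated_convergence)
    show "G' \<in> borel_measurable lborel" using G'int by simp
    show "s n \<in> borel_measurable lborel" for n
      unfolding s_def by measurable
    \<comment> \<open>Since \<open>0 < h n \<le> 1\<close>, neither \<open>x\<close> nor
      \<open>x + h n *\<^sub>R i\<close> lies in the box unless \<open>x\<close> lies in the box
      enlarged by one unit downwards along \<open>i\<close>. There the Lipschitz bound gives
      \<open>M\<close>.\<close>
    show "integrable lborel (\<lambda>x. indicator (cbox (a - i) b) x * M)"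
      by (intro integrable_mult_left integrable_real_indicator emeasure_compact_finite) auto
    show "AE x in lborel. norm (s n x) \<le> indicator (cbox (a - i) b) x * M" for n
    proof (rule AE_I2)
      fix x
      show "norm (s n x) \<le> indicator (cbox (a - i) b) x * M"
      proof (cases "x \<in> cbox (a - i) b")
        case True
        then show ?thesis
          using lip[of "h n" x] h[of n] by (simp add: s_def divide_le_eq)
      next
        case False
        have "x \<notin> cbox a b"
        proof
          assume x: "x \<in> cbox a b"
          have "x \<in> cbox (a - i) b"
            unfolding mem_box
          proof
            fix j :: 'a assume j: "j \<in> Basis"
            show "(a - i) \<bullet> j \<le> x \<bullet> j \<and> x \<bullet> j \<le> b \<bullet> j"
              using x[unfolded mem_box, rule_format, OF j] i j by (auto simp: inner_diff_left inner_Basis)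
          qed
          with False show False by blast
        qed
        moreover have "x + h n *\<^sub>R i \<notin> cbox a b"
        proof
          assume x: "x + h n *\<^sub>R i \<in> cbox a b"
          have "x \<in> cbox (a - i) b"
            unfolding mem_box
          proof
            fix j :: 'a assume j: "j \<in> Basis"
            show "(a - i) \<bullet> j \<le> x \<bullet> j \<and> x \<bullet> j \<le> b \<bullet> j"
              using x[unfolded mem_box, rule_format, OF j] i j h[of n]
              by (auto simp: comp[OF j] inner_diff_left inner_Basis split: if_splits)
          qed
          with False show False by blast
        qed
        ultimately show ?thesis using False by (simp add: s_def G_def)
      qed
    qed
    \<comment> \<open>The frontier is a null set. At interior points the quotients converge to the
      two-sided derivative along \<open>i\<close>; at exterior points they are eventually 0.\<close>
    have "cbox a b - box a b \<in> null_sets lborel"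
      using negligible_frontier_interval[of a b]
      by (simp add: negligible_iff_null_sets null_sets_completion_iff)
    then have "AE x in lborel. x \<notin> cbox a b - box a b" by (rule AE_not_in)
    then show "AE x in lborel. (\<lambda>n. s n x) \<longlonglongrightarrow> G' x"
    proof eventually_elim
      fix x assume x: "x \<notin> cbox a b - box a b"
      have h0: "h \<longlonglongrightarrow> 0" unfolding h_def by (rule LIMSEQ_inverse_real_of_nat)
      have shift: "(\<lambda>n. x + h n *\<^sub>R i) \<longlonglongrightarrow> x"
        using tendsto_add[OF tendsto_const tendsto_scaleR[OF h0 tendsto_const], of x i] by simp
      show "(\<lambda>n. s n x) \<longlonglongrightarrow> G' x"
      proof (cases "x \<in> cbox a b")
        case False
        then have "open (- cbox a b)" "x \<in> - cbox a b" by auto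
        then have "eventually (\<lambda>n. x + h n *\<^sub>R i \<in> - cbox a b) sequentially"
          by (rule topological_tendstoD[OF shift])
        then have "eventually (\<lambda>n. s n x = 0) sequentially"
          by eventually_elim (use False in \<open>simp add: s_def G_def\<close>)
        then show ?thesis
          using False by (simp add: G'_def tendsto_eventually)
      next
        case True
        define S where "S = {k. x + k *\<^sub>R i \<in> box a b}"
        have "open ((\<lambda>k. x + k *\<^sub>R i) -` box a b)"
          by (intro open_vimage open_box continuous_intros)
        then have S: "open S" by (simp add: S_def vimage_def)
        have S0: "0 \<in> S" using x True by (simp add: S_def)
        have "((\<lambda>k. g (x + k *\<^sub>R i)) has_real_derivative D (x + 0 *\<^sub>R i) i) (at 0 within S)"
          using S0 box_subset_cbox[of a b] by (intro line) (auto simp: S_def)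
        then have "((\<lambda>k. g (x + k *\<^sub>R i)) has_real_derivative D x i) (at 0)"
          using at_within_open[OF S0 S] by simp
        then have "((\<lambda>k. (g (x + k *\<^sub>R i) - g x) / k) \<longlongrightarrow> D x i) (at 0)"
          by (simp add: DERIV_def)
        moreover have "filterlim h (at 0) sequentially"
          using h0 h(1) by (auto simp: filterlim_at less_imp_neq[symmetric])
        ultimately have lim: "(\<lambda>n. (g (x + h n *\<^sub>R i) - g x) / h n) \<longlonglongrightarrow> D x i"
          by (rule filterlim_compose)
        have "eventually (\<lambda>n. h n \<in> S) sequentially"
          by (rule topological_tendstoD[OF h0 S S0])
        then have "eventually (\<lambda>n. (g (x + h n *\<^sub>R i) - g x) / h n = s n x) sequentially"
        proof eventually_elim
          case (elim n)
          then have "x + h n *\<^sub>R i \<in> cbox a b" using box_subset_cbox[of a b] by (auto simp: S_def)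
          then show ?case using True by (simp add: s_def G_def)
        qed
        from Lim_transform_eventually[OF lim this] show ?thesis
          using True by (simp add: G'_def)
      qed
    qed
  qed
  moreover have "integral\<^sup>L lborel (s n) = 0" for n
    unfolding s_def using Gint Gint_shift by (simp add: G_shift)
  ultimately have "integral\<^sup>L lborel G' = 0"
    by (simp add: LIMSEQ_const_iff)
  moreover have "integral (cbox a b) (\<lambda>x. D x i) = integral\<^sup>L lborel G'"
  proof -
    have eq: "G' = (\<lambda>x. if x \<in> cbox a b then D x i else 0)" by (auto simp: G'_def)
    have "integral\<^sup>L lborel G' = integral UNIV G'" using integral_lborel[OF G'int] by simp
    also have "\<dots> = integral (cbox a b) (\<lambda>x. D x i)"
      unfolding eq by (rule integral_restrict_UNIV)
    finally show ?thesis by simp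
  qed
  ultimately show ?thesis by simp
qed

text \<open>One summand of the divergence theorem at a frozen time. Only the two faces normal to
  \<open>i\<close> are constrained, so different directions may have different reasons for a
  vanishing boundary value.\<close>

lemma integral_spatial_derivative_eq_0:
  fixes f :: "(real^'n) \<times> real \<Rightarrow> real"
  assumes f: "C1_on (cbox a b \<times> J) f f'" and s: "s \<in> J"
    and zero: "\<And>x. x \<in> cbox a b \<Longrightarrow> x $ i = a $ i \<or> x $ i = b $ i \<Longrightarrow> f (x, s) = 0"
  shows "integral (cbox a b) (\<lambda>x. f' (x, s) (axis i 1, 0)) = 0"
proof (rule integral_partial_derivative_eq_0[where g = "\<lambda>x. f (x, s)" and D = "\<lambda>x v. f' (x, s) (v, 0)"])
  show "axis i (1::real) \<in> Basis" by (simp add: axis_in_Basis_iff)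
  show "((\<lambda>x. f (x, s)) has_derivative (\<lambda>v. f' (x, s) (v, 0))) (at x within cbox a b)"
    if "x \<in> cbox a b" for x
    using f that s by (rule C1_on_spatial_derivative)
  show "continuous_on (cbox a b) (\<lambda>x. f' (x, s) (axis i 1, 0))"
    by (rule continuous_on_time_slice[OF C1_on_continuous_derivative[OF f] s])
qed (use zero in \<open>auto simp: inner_axis\<close>)

section \<open>Thin layers next to the level set\<close>

text \<open>The minimum over \<open>K\<close> of
  \<open>max \<bar>f p\<bar> (\<eta> - \<bar>g p\<bar>)\<close> is positive, because
  \<open>g\<close> vanishes wherever \<open>f\<close> does. It serves as \<open>\<epsilon>\<close>:
  if \<open>\<bar>f p\<bar>\<close> lies below it, the second entry must be positive.\<close>

lemma small_near_zero_set:
  fixes f g :: "'a::topological_space \<Rightarrow> real"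
  assumes K: "compact K" and f: "continuous_on K f" and g: "continuous_on K g"
    and zero: "\<And>p. p \<in> K \<Longrightarrow> f p = 0 \<Longrightarrow> g p = 0" and "0 < \<eta>"
  obtains \<epsilon> where "0 < \<epsilon>" "\<And>p. p \<in> K \<Longrightarrow> \<bar>f p\<bar> < \<epsilon> \<Longrightarrow> \<bar>g p\<bar> < \<eta>"
proof (cases "K = {}")
  case True
  then show ?thesis using that[of 1] by simp
next
  case False
  have "continuous_on K (\<lambda>p. max \<bar>f p\<bar> (\<eta> - \<bar>g p\<bar>))"
    using f g by (intro continuous_intros)
  from continuous_attains_inf[OF K False this] obtain q where q: "q \<in> K"
    and min: "\<And>p. p \<in> K \<Longrightarrow> max \<bar>f q\<bar> (\<eta> - \<bar>g q\<bar>) \<le> max \<bar>f p\<bar> (\<eta> - \<bar>g p\<bar>)"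
    by blast
  have "0 < max \<bar>f q\<bar> (\<eta> - \<bar>g q\<bar>)"
    using zero[OF q] \<open>0 < \<eta>\<close> by (cases "f q = 0") (auto simp: less_max_iff_disj)
  then show ?thesis
  proof (rule that)
    fix p assume "p \<in> K" "\<bar>f p\<bar> < max \<bar>f q\<bar> (\<eta> - \<bar>g q\<bar>)"
    with min[of p] \<open>0 < max \<bar>f q\<bar> (\<eta> - \<bar>g q\<bar>)\<close> show "\<bar>g p\<bar> < \<eta>" by linarith
  qed
qed

text \<open>The case \<open>\<epsilon> = 0\<close> is included: division by zero gives 0, so the
  function is constant and the stated derivative is 0.\<close>

lemma C1_on_cutoff:
  assumes "C1_on S \<theta> \<theta>'"
  shows "C1_on S (\<lambda>p. cutoff (- \<theta> p / \<epsilon>)) (\<lambda>p v. - cutoff' (- \<theta> p / \<epsilon>) / \<epsilon> * \<theta>' p v)"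
proof (rule C1_on_compose[OF assms])
  show "((\<lambda>z. cutoff (- z / \<epsilon>)) has_real_derivative - cutoff' (- z / \<epsilon>) / \<epsilon>) (at z within \<theta> ` S)" for z
    by (rule DERIV_cong[OF DERIV_chain2[OF cutoff_deriv, of "\<lambda>z. - z / \<epsilon>" "- 1 / \<epsilon>"]])
      (cases "\<epsilon> = 0"; auto intro!: derivative_eq_intros)+
  show "continuous_on (\<theta> ` S) (\<lambda>z. - cutoff' (- z / \<epsilon>) / \<epsilon>)"
    by (cases "\<epsilon> = 0") (auto intro!: continuous_intros continuous_on_compose2[OF continuous_on_cutoff'[of UNIV]])
qed

lemma continuous_on_compact_bound:
  fixes f :: "'a::topological_space \<Rightarrow> real"
  assumes "compact K" "continuous_on K f"
  obtains M where "0 < M" "\<And>p. p \<in> K \<Longrightarrow> \<bar>f p\<bar> \<le> M"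
  using compact_imp_bounded[OF compact_continuous_image[OF assms(2,1)]]
  by (auto simp: bounded_pos)

text \<open>The integrals below are smoothed perimeters of the slices of the level set. They are bounded
  by the divergence theorem for a polynomial field \<open>w\<close> close to the gradient, which is itself only
  continuous.\<close>

lemma level_set_layer_bound:
  fixes \<theta> :: "(real^'n) \<times> real \<Rightarrow> real"
  assumes \<theta>: "C1_on (cbox a b \<times> {t0..t1}) \<theta> \<theta>'"
    and grad: "\<And>p. p \<in> cbox a b \<times> {t0..t1} \<Longrightarrow> \<theta> p = 0 \<Longrightarrow> \<exists>i\<in>I. \<theta>' p (axis i 1, 0) \<noteq> 0"
    and faces: "\<And>x s i. x \<in> cbox a b \<Longrightarrow> s \<in> {t0..t1} \<Longrightarrow> i \<in> I \<Longrightarrow> x $ i = a $ i \<or> x $ i = b $ i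
      \<Longrightarrow> 0 \<le> \<theta> (x, s)"
  obtains C \<epsilon>0 where "0 \<le> C" "0 < \<epsilon>0"
    "\<And>\<epsilon> s. 0 < \<epsilon> \<Longrightarrow> \<epsilon> \<le> \<epsilon>0 \<Longrightarrow> s \<in> {t0..t1} \<Longrightarrow>
      integral (cbox a b) (\<lambda>x. cutoff' (- \<theta> (x, s) / \<epsilon>) / \<epsilon>) \<le> C"
proof (cases "cbox a b \<times> {t0..t1} = {}")
  case True
  then show ?thesis using that[of 0 1] by auto
next
  case False
  define K where "K = cbox a b \<times> {t0..t1}"
  have K: "compact K" "K \<noteq> {}" using False by (auto simp: K_def compact_Times)
  define d where "d i p = \<theta>' p (axis i 1, 0)" for i p
  have d_cont: "continuous_on K (d i)" for i
    unfolding d_def K_def by (rule C1_on_continuous_derivative[OF \<theta>])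
  have \<theta>_cont: "continuous_on K \<theta>"
    unfolding K_def by (rule C1_on_continuous[OF \<theta>])
  \<comment> \<open>Nondegeneracy made quantitative: this sum has a positive minimum
    \<open>c\<close> on \<open>K\<close>, so the squared gradient in the directions \<open>I\<close>
    exceeds \<open>c / 2\<close> wherever \<open>\<bar>\<theta> p\<bar> < c / 2\<close>.\<close>
  have "continuous_on K (\<lambda>p. \<bar>\<theta> p\<bar> + (\<Sum>i\<in>I. (d i p)\<^sup>2))"
    by (intro continuous_intros \<theta>_cont d_cont)
  from continuous_attains_inf[OF K this] obtain q where q: "q \<in> K"
    and min: "\<And>p. p \<in> K \<Longrightarrow> \<bar>\<theta> q\<bar> + (\<Sum>i\<in>I. (d i q)\<^sup>2) \<le> \<bar>\<theta> p\<bar> + (\<Sum>i\<in>I. (d i p)\<^sup>2)"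
    by blast
  define c where "c = \<bar>\<theta> q\<bar> + (\<Sum>i\<in>I. (d i q)\<^sup>2)"
  have c: "0 < c"
  proof (cases "\<theta> q = 0")
    case True
    then obtain i where "i \<in> I" "d i q \<noteq> 0" using grad q by (auto simp: K_def d_def)
    then have "0 < (\<Sum>i\<in>I. (d i q)\<^sup>2)" by (intro sum_pos2[of I i]) auto
    then show ?thesis by (simp add: c_def)
  next
    case False
    then show ?thesis by (simp add: c_def add_pos_nonneg sum_nonneg)
  qed
  have "continuous_on K (\<lambda>p. \<Sum>i\<in>I. \<bar>d i p\<bar>)" by (intro continuous_intros d_cont)
  then obtain M where M: "0 < M" "\<And>p. p \<in> K \<Longrightarrow> \<bar>\<Sum>i\<in>I. \<bar>d i p\<bar>\<bar> \<le> M"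
    using continuous_on_compact_bound[OF K(1)] by blast
  \<comment> \<open>Replacing the gradient by a field within \<open>\<kappa>\<close> of it costs at
    most \<open>\<kappa> * M = c / 4\<close>, which leaves \<open>c / 4\<close> of the lower bound
    \<open>c / 2\<close>.\<close>
  define \<kappa> where "\<kappa> = c / (4 * M)"
  have \<kappa>: "0 < \<kappa>" using c M by (simp add: \<kappa>_def)
  have "\<exists>w w'. C1_on UNIV w w' \<and> (\<forall>p\<in>K. \<bar>d i p - w p\<bar> < \<kappa>)" for i
    using Stone_Weierstrass_real_polynomial_function[OF K(1) d_cont \<kappa>] real_polynomial_function_C1 by metis
  then obtain w w' where w_UNIV: "\<And>i. C1_on UNIV (w i) (w' i)"
    and w_near: "\<And>i p. p \<in> K \<Longrightarrow> \<bar>d i p - w i p\<bar> < \<kappa>"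
    by metis
  have w: "C1_on K (w i) (w' i)" for i using w_UNIV by (rule C1_on_subset) simp
  have transversal: "c / 4 \<le> (\<Sum>i\<in>I. w i p * d i p)" if p: "p \<in> K" and small: "\<bar>\<theta> p\<bar> < c / 2" for p
  proof -
    have "(\<Sum>i\<in>I. (d i p)\<^sup>2) - (\<Sum>i\<in>I. w i p * d i p) = (\<Sum>i\<in>I. (d i p - w i p) * d i p)"
      by (simp add: sum_subtractf algebra_simps power2_eq_square)
    also have "\<dots> \<le> (\<Sum>i\<in>I. \<kappa> * \<bar>d i p\<bar>)"
    proof (rule sum_mono)
      fix i
      have "(d i p - w i p) * d i p \<le> \<bar>d i p - w i p\<bar> * \<bar>d i p\<bar>"
        by (metis abs_ge_self abs_mult)
      also have "\<dots> \<le> \<kappa> * \<bar>d i p\<bar>"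
        using w_near[OF p, of i] by (intro mult_right_mono) auto
      finally show "(d i p - w i p) * d i p \<le> \<kappa> * \<bar>d i p\<bar>" .
    qed
    also have "\<dots> = \<kappa> * (\<Sum>i\<in>I. \<bar>d i p\<bar>)" by (simp add: sum_distrib_left)
    also have "\<dots> \<le> \<kappa> * M" using M(2)[OF p] \<kappa> by (intro mult_left_mono) auto
    also have "\<dots> = c / 4" using M by (simp add: \<kappa>_def)
    finally show ?thesis using min[OF p] small by (simp add: c_def)
  qed
  define dv where "dv p = (\<Sum>i\<in>I. w' i p (axis i 1, 0))" for p
  have dv_cont: "continuous_on K dv"
    unfolding dv_def by (intro continuous_intros C1_on_continuous_derivative[OF w])
  obtain B where B: "0 < B" "\<And>p. p \<in> K \<Longrightarrow> \<bar>dv p\<bar> \<le> B"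
    using continuous_on_compact_bound[OF K(1) dv_cont] by blast
  \<comment> \<open>The threshold \<open>c / 2\<close> keeps the layer
    \<open>- \<epsilon> < \<theta> < 0\<close> inside the region where \<open>transversal\<close>
    applies; the factor \<open>4 / c\<close> inverts the bound obtained there.\<close>
  show ?thesis
  proof (rule that[of "4 / c * (B * measure lborel (cbox a b))" "c / 2"])
    fix \<epsilon> s assume \<epsilon>: "0 < \<epsilon>" "\<epsilon> \<le> c / 2" and s: "s \<in> {t0..t1}"
    define H where "H p = cutoff (- \<theta> p / \<epsilon>)" for p
    define L where "L p = cutoff' (- \<theta> p / \<epsilon>) / \<epsilon>" for p
    define H' where "H' p v = - L p * \<theta>' p v" for p v
    have H: "C1_on K H H'"
      using C1_on_cutoff[OF \<theta>, of \<epsilon>] by (simp add: K_def H_def[abs_def] H'_def[abs_def] L_def)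
    have L_nonneg: "0 \<le> L p" for p using \<epsilon> by (simp add: L_def cutoff'_nonneg)
    have L_cont: "continuous_on K L"
      unfolding L_def using \<epsilon> by (intro continuous_intros continuous_on_compose2[OF continuous_on_cutoff'[of UNIV]] \<theta>_cont) auto
    define f' where "f' i p v = w i p * H' p v + w' i p v * H p" for i p v
    have f: "C1_on K (\<lambda>p. w i p * H p) (f' i)" for i
      unfolding f'_def by (rule C1_on_mult[OF w H])
    have slice: "(\<lambda>x. g (x, s)) integrable_on cbox a b" if "continuous_on K g" for g :: "(real^'n) \<times> real \<Rightarrow> real"
      using continuous_on_time_slice[OF that[unfolded K_def] s] by (rule integrable_continuous)
    have f'0: "integral (cbox a b) (\<lambda>x. f' i (x, s) (axis i 1, 0)) = 0" if "i \<in> I" for i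
    proof (rule integral_spatial_derivative_eq_0[OF f[unfolded K_def] s])
      fix x assume "x \<in> cbox a b" "x $ i = a $ i \<or> x $ i = b $ i"
      then have "0 \<le> \<theta> (x, s)" using faces s that by blast
      then show "w i (x, s) * H (x, s) = 0" using \<epsilon> by (simp add: H_def)
    qed
    have f'_sum: "integral (cbox a b) (\<lambda>x. \<Sum>i\<in>I. f' i (x, s) (axis i 1, 0)) = 0"
      by (subst integral_sum) (auto simp: f'0 intro!: slice C1_on_continuous_derivative[OF f])
    \<comment> \<open>The divergence of \<open>w H\<close> is \<open>H\<close> times the divergence
      of \<open>w\<close>, minus \<open>L\<close> times \<open>w\<close> paired with the gradient of
      \<open>\<theta>\<close>. As \<open>L\<close> vanishes off the layer, that pairing needs its
      lower bound only there.\<close>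
    have pointwise: "c / 4 * L p \<le> dv p * H p - (\<Sum>i\<in>I. f' i p (axis i 1, 0))" if p: "p \<in> K" for p
    proof -
      have "(\<Sum>i\<in>I. f' i p (axis i 1, 0)) = dv p * H p - L p * (\<Sum>i\<in>I. w i p * d i p)"
        by (simp add: f'_def H'_def d_def dv_def sum_subtractf sum_distrib_left sum_distrib_right algebra_simps)
      moreover have "c / 4 * L p \<le> L p * (\<Sum>i\<in>I. w i p * d i p)"
      proof (cases "- \<theta> p / \<epsilon> \<in> {0<..<1}")
        case True
        then have "\<bar>\<theta> p\<bar> < c / 2" using \<epsilon> by (auto simp: field_simps)
        then show ?thesis using mult_left_mono[OF transversal[OF p] L_nonneg[of p]] by (simp add: mult.commute)
      next
        case False
        then show ?thesis by (simp add: L_def cutoff'_eq_0)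
      qed
      ultimately show ?thesis by simp
    qed
    have H_cont: "continuous_on K H" by (rule C1_on_continuous[OF H])
    have "c / 4 * integral (cbox a b) (\<lambda>x. L (x, s)) = integral (cbox a b) (\<lambda>x. c / 4 * L (x, s))"
      by simp
    also have "\<dots> \<le> integral (cbox a b) (\<lambda>x. dv (x, s) * H (x, s) - (\<Sum>i\<in>I. f' i (x, s) (axis i 1, 0)))"
    proof (rule integral_le)
      show "(\<lambda>x. c / 4 * L (x, s)) integrable_on cbox a b"
        by (rule slice) (intro continuous_intros L_cont)
      show "(\<lambda>x. dv (x, s) * H (x, s) - (\<Sum>i\<in>I. f' i (x, s) (axis i 1, 0))) integrable_on cbox a b"
        by (rule slice) (intro continuous_intros dv_cont H_cont C1_on_continuous_derivative[OF f])
    qed (use pointwise s in \<open>auto simp: K_def\<close>)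
    also have "\<dots> = integral (cbox a b) (\<lambda>x. dv (x, s) * H (x, s))"
    proof (subst integral_diff)
      show "(\<lambda>x. dv (x, s) * H (x, s)) integrable_on cbox a b"
        by (rule slice) (intro continuous_intros dv_cont H_cont)
      show "(\<lambda>x. \<Sum>i\<in>I. f' i (x, s) (axis i 1, 0)) integrable_on cbox a b"
        by (rule slice) (intro continuous_intros C1_on_continuous_derivative[OF f])
    qed (simp add: f'_sum)
    also have "\<dots> \<le> integral (cbox a b) (\<lambda>x. B)"
    proof (rule integral_le)
      show "(\<lambda>x. dv (x, s) * H (x, s)) integrable_on cbox a b"
        by (rule slice) (intro continuous_intros dv_cont H_cont)
      fix x assume "x \<in> cbox a b"
      then have "dv (x, s) \<le> B" using B(2)[of "(x, s)"] s by (auto simp: K_def)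
      then have "dv (x, s) * H (x, s) \<le> B * H (x, s)"
        by (intro mult_right_mono) (auto simp: H_def cutoff_nonneg)
      also have "\<dots> \<le> B" using B(1) cutoff_le_1 by (simp add: H_def)
      finally show "dv (x, s) * H (x, s) \<le> B" .
    qed auto
    also have "\<dots> = B * measure lborel (cbox a b)" by simp
    finally show "integral (cbox a b) (\<lambda>x. cutoff' (- \<theta> (x, s) / \<epsilon>) / \<epsilon>) \<le> 4 / c * (B * measure lborel (cbox a b))"
      using c by (simp add: L_def field_simps)
  qed (use c B in auto)
qed

section \<open>Almost monotonicity of the localized volume\<close>

text \<open>No flux crosses the faces of the box: on those normal to a direction in \<open>I\<close>
  the cutoff of the tube vanishes, on the others \<open>\<psi>\<close> does. Inside,
  \<open>\<psi>\<close> does not decrease along \<open>u\<close> by \<open>\<psi>_moves\<close>. The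
  left side depends neither on the layer width nor on \<open>t1\<close>, which makes the bound
  uniform in time.\<close>

lemma localized_volume_le:
  fixes \<theta> \<psi> :: "(real^'n) \<times> real \<Rightarrow> real" and u :: "'n \<Rightarrow> (real^'n) \<times> real \<Rightarrow> real"
  assumes t: "t0 \<le> t1"
    and \<theta>: "C1_on (cbox a b \<times> {t0..t1}) \<theta> \<theta>'"
    and u: "\<And>i. C1_on (cbox a b \<times> {t0..t1}) (u i) (u' i)"
    and \<psi>: "C1_on (cbox a b \<times> {t0..t1}) \<psi> \<psi>'"
    and grad: "\<And>p. p \<in> cbox a b \<times> {t0..t1} \<Longrightarrow> \<theta> p = 0 \<Longrightarrow> \<exists>i\<in>I. \<theta>' p (axis i 1, 0) \<noteq> 0"
    and faces: "\<And>x s i. x \<in> cbox a b \<Longrightarrow> s \<in> {t0..t1} \<Longrightarrow> i \<in> I \<Longrightarrow> x $ i = a $ i \<or> x $ i = b $ i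
      \<Longrightarrow> 0 \<le> \<theta> (x, s)"
    and \<psi>_faces: "\<And>x s i. x \<in> cbox a b \<Longrightarrow> s \<in> {t0..t1} \<Longrightarrow> i \<notin> I \<Longrightarrow> x $ i = a $ i \<or> x $ i = b $ i
      \<Longrightarrow> \<psi> (x, s) = 0"
    and div: "\<And>p. p \<in> cbox a b \<times> {t0..t1} \<Longrightarrow> (\<Sum>i\<in>UNIV. u' i p (axis i 1, 0)) = 0"
    and moves: "\<And>p. p \<in> cbox a b \<times> {t0..t1} \<Longrightarrow> \<theta> p = 0 \<Longrightarrow>
      \<theta>' p (0, 1) + (\<Sum>i\<in>UNIV. u i p * \<theta>' p (axis i 1, 0)) = 0"
    and \<psi>_bounds: "\<And>p. p \<in> cbox a b \<times> {t0..t1} \<Longrightarrow> 0 \<le> \<psi> p" "\<And>p. p \<in> cbox a b \<times> {t0..t1} \<Longrightarrow> \<psi> p \<le> B"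
    and B: "0 \<le> B"
    and \<psi>_moves: "\<And>p. p \<in> cbox a b \<times> {t0..t1} \<Longrightarrow>
      0 \<le> \<psi>' p (0, 1) + (\<Sum>i\<in>UNIV. u i p * \<psi>' p (axis i 1, 0))"
  shows "integral (cbox a b) (\<lambda>x. cutoff (- \<theta> (x, t0)) * \<psi> (x, t0))
    \<le> B * measure lebesgue {x \<in> cbox a b. \<theta> (x, t1) < 0}"
proof (rule field_le_epsilon)
  fix e :: real assume e: "0 < e"
  define K where "K = cbox a b \<times> {t0..t1}"
  have K: "compact K" by (auto simp: K_def compact_Times)
  note \<theta> = \<theta>[folded K_def] and u = u[folded K_def] and \<psi> = \<psi>[folded K_def]
  note \<theta>_cont = C1_on_continuous[OF \<theta>] and u_cont = C1_on_continuous[OF u] and \<psi>_cont = C1_on_continuous[OF \<psi>]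
  have slice: "(\<lambda>x. g (x, s)) integrable_on cbox a b"
    if "continuous_on K g" "s \<in> {t0..t1}" for g :: "(real^'n) \<times> real \<Rightarrow> real" and s
    using continuous_on_time_slice[OF that(1)[unfolded K_def] that(2)] by (rule integrable_continuous)
  obtain C \<epsilon>0 where C: "0 \<le> C" and \<epsilon>0: "0 < \<epsilon>0"
    and layer: "\<And>\<epsilon> s. 0 < \<epsilon> \<Longrightarrow> \<epsilon> \<le> \<epsilon>0 \<Longrightarrow> s \<in> {t0..t1} \<Longrightarrow>
      integral (cbox a b) (\<lambda>x. cutoff' (- \<theta> (x, s) / \<epsilon>) / \<epsilon>) \<le> C"
  proof (rule level_set_layer_bound[OF \<theta>[unfolded K_def], of I])
    show "\<exists>i\<in>I. \<theta>' p (axis i 1, 0) \<noteq> 0" if "p \<in> cbox a b \<times> {t0..t1}" "\<theta> p = 0" for p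
      using that by (rule grad)
    show "0 \<le> \<theta> (x, s)"
      if "x \<in> cbox a b" "s \<in> {t0..t1}" "i \<in> I" "x $ i = a $ i \<or> x $ i = b $ i" for x s i
      using that by (rule faces)
  qed blast
  define N where "N = B * C * (t1 - t0)"
  have N: "0 \<le> N" using B C t by (simp add: N_def)
  \<comment> \<open>The loss over the whole time interval will be at most \<open>\<eta> * N\<close>.
    The added 1 keeps the denominator positive when \<open>N = 0\<close>.\<close>
  define \<eta> where "\<eta> = e / (N + 1)"
  have \<eta>: "0 < \<eta>" "\<eta> * N \<le> e" using e N by (auto simp: \<eta>_def field_simps)
  define D\<theta> where "D\<theta> p = \<theta>' p (0, 1) + (\<Sum>i\<in>UNIV. u i p * \<theta>' p (axis i 1, 0))" for p
  have D\<theta>_cont: "continuous_on K D\<theta>"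
    unfolding D\<theta>_def by (intro continuous_intros u_cont C1_on_continuous_derivative[OF \<theta>])
  have D\<theta>_zero: "D\<theta> p = 0" if "p \<in> K" "\<theta> p = 0" for p
    using moves that by (simp add: D\<theta>_def K_def)
  obtain \<epsilon>1 where \<epsilon>1: "0 < \<epsilon>1" "\<And>p. p \<in> K \<Longrightarrow> \<bar>\<theta> p\<bar> < \<epsilon>1 \<Longrightarrow> \<bar>D\<theta> p\<bar> < \<eta>"
    using small_near_zero_set[OF K \<theta>_cont D\<theta>_cont D\<theta>_zero \<eta>(1)] by blast
  \<comment> \<open>The bound 1 serves the comparison with \<open>cutoff (- \<theta>)\<close> at
    time \<open>t0\<close>, \<open>\<epsilon>0\<close> the layer estimate, and
    \<open>\<epsilon>1\<close> the smallness of \<open>D\<theta>\<close> on the layer.\<close>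
  define \<epsilon> where "\<epsilon> = min 1 (min \<epsilon>0 \<epsilon>1)"
  have \<epsilon>: "0 < \<epsilon>" "\<epsilon> \<le> 1" "\<epsilon> \<le> \<epsilon>0" "\<epsilon> \<le> \<epsilon>1" using \<epsilon>0 \<epsilon>1 by (auto simp: \<epsilon>_def)
  define H where "H p = cutoff (- \<theta> p / \<epsilon>)" for p
  define L where "L p = cutoff' (- \<theta> p / \<epsilon>) / \<epsilon>" for p
  define H' where "H' p v = - L p * \<theta>' p v" for p v
  have H: "C1_on K H H'"
    using C1_on_cutoff[OF \<theta>, of \<epsilon>] by (simp add: H_def[abs_def] H'_def[abs_def] L_def)
  have H_nonneg: "0 \<le> H p" for p by (simp add: H_def cutoff_nonneg)
  have L_nonneg: "0 \<le> L p" for p using \<epsilon> by (simp add: L_def cutoff'_nonneg)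
  have L_cont: "continuous_on K L"
    unfolding L_def using \<epsilon> by (intro continuous_intros continuous_on_compose2[OF continuous_on_cutoff'[of UNIV]] \<theta>_cont) auto
  define \<Phi> where "\<Phi> p = H p * \<psi> p" for p
  define \<Phi>' where "\<Phi>' p v = H p * \<psi>' p v + H' p v * \<psi> p" for p v
  have \<Phi>: "C1_on K \<Phi> \<Phi>'"
    unfolding \<Phi>_def \<Phi>'_def by (rule C1_on_mult[OF H \<psi>])
  define f' where "f' i p v = u i p * \<Phi>' p v + u' i p v * \<Phi> p" for i p v
  have f: "C1_on K (\<lambda>p. u i p * \<Phi> p) (f' i)" for i
    unfolding f'_def by (rule C1_on_mult[OF u \<Phi>])
  define F where "F s = integral (cbox a b) (\<lambda>x. \<Phi> (x, s))" for s
  define F' where "F' s = integral (cbox a b) (\<lambda>x. \<Phi>' (x, s) (0, 1))" for s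
  have F_deriv: "(F has_real_derivative F' s) (at s within {t0..t1})" if s: "s \<in> {t0..t1}" for s
    unfolding F_def F'_def
  proof (rule leibniz_rule_field_derivative[where U = "{t0..t1}"])
    show "((\<lambda>s. \<Phi> (x, s)) has_real_derivative \<Phi>' (x, s) (0, 1)) (at s within {t0..t1})"
      if "s \<in> {t0..t1}" "x \<in> cbox a b" for s x
      using C1_on_time_derivative[OF \<Phi>[unfolded K_def]] that by blast
    show "continuous_on ({t0..t1} \<times> cbox a b) (\<lambda>(s, x). \<Phi>' (x, s) (0, 1))"
      unfolding split_beta
      by (rule continuous_on_compose2[OF C1_on_continuous_derivative[OF \<Phi>, of "(0, 1)"]])
        (auto simp: K_def intro!: continuous_intros)
  qed (use s in \<open>auto intro!: slice C1_on_continuous[OF \<Phi>]\<close>)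
  have F'_lower: "- (\<eta> * B * C) \<le> F' s" if s: "s \<in> {t0..t1}" for s
  proof -
    have f'0: "integral (cbox a b) (\<lambda>x. f' i (x, s) (axis i 1, 0)) = 0" for i
    proof (rule integral_spatial_derivative_eq_0[OF f[unfolded K_def] s])
      fix x assume x: "x \<in> cbox a b" "x $ i = a $ i \<or> x $ i = b $ i"
      show "u i (x, s) * \<Phi> (x, s) = 0"
      proof (cases "i \<in> I")
        case True
        then have "0 \<le> \<theta> (x, s)" using faces s x by blast
        then show ?thesis using \<epsilon> by (simp add: \<Phi>_def H_def)
      next
        case False
        then show ?thesis using \<psi>_faces s x by (simp add: \<Phi>_def)
      qed
    qed
    \<comment> \<open>The right side is the time derivative of \<open>\<Phi>\<close> plus the
      divergence of \<open>u \<Phi>\<close>. Incompressibility removes one term and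
      \<open>\<psi>_moves\<close> gives a sign to another; what remains contains
      \<open>D\<theta>\<close> and is supported in the layer.\<close>
    have pointwise: "- (\<eta> * B) * L p \<le> \<Phi>' p (0, 1) + (\<Sum>i\<in>UNIV. f' i p (axis i 1, 0))" if p: "p \<in> K" for p
    proof -
      have "\<Phi>' p (0, 1) + (\<Sum>i\<in>UNIV. f' i p (axis i 1, 0)) =
          H p * (\<psi>' p (0, 1) + (\<Sum>i\<in>UNIV. u i p * \<psi>' p (axis i 1, 0)))
          - L p * \<psi> p * D\<theta> p + \<Phi> p * (\<Sum>i\<in>UNIV. u' i p (axis i 1, 0))"
        by (simp add: f'_def \<Phi>'_def H'_def D\<theta>_def sum.distrib sum_subtractf sum_distrib_left algebra_simps)
      moreover have "(\<Sum>i\<in>UNIV. u' i p (axis i 1, 0)) = 0" using div p by (simp add: K_def)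
      moreover have "0 \<le> H p * (\<psi>' p (0, 1) + (\<Sum>i\<in>UNIV. u i p * \<psi>' p (axis i 1, 0)))"
        using \<psi>_moves p H_nonneg by (simp add: K_def)
      moreover have "L p * \<psi> p * D\<theta> p \<le> \<eta> * B * L p"
      proof (cases "- \<theta> p / \<epsilon> \<in> {0<..<1}")
        case True
        then have "\<bar>\<theta> p\<bar> < \<epsilon>1" using \<epsilon> by (auto simp: field_simps)
        then have "D\<theta> p \<le> \<eta>" using \<epsilon>1(2)[OF p] by simp
        have \<psi>p: "0 \<le> \<psi> p" "\<psi> p \<le> B" using \<psi>_bounds p by (auto simp: K_def)
        have "L p * \<psi> p * D\<theta> p \<le> L p * \<psi> p * \<eta>"
          using \<open>D\<theta> p \<le> \<eta>\<close> \<psi>p L_nonneg by (simp add: mult_left_mono)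
        also have "\<dots> \<le> L p * B * \<eta>"
          using \<psi>p L_nonneg \<eta> by (intro mult_right_mono mult_left_mono) auto
        finally show ?thesis by (simp add: mult_ac)
      next
        case False
        then show ?thesis by (simp add: L_def cutoff'_eq_0)
      qed
      ultimately show ?thesis by simp
    qed
    have f'_int: "(\<lambda>x. \<Sum>i\<in>UNIV. f' i (x, s) (axis i 1, 0)) integrable_on cbox a b"
      by (rule slice[OF _ s]) (intro continuous_intros C1_on_continuous_derivative[OF f])
    have \<Phi>'_int: "(\<lambda>x. \<Phi>' (x, s) (0, 1)) integrable_on cbox a b"
      by (rule slice[OF C1_on_continuous_derivative[OF \<Phi>] s])
    have "- (\<eta> * B * C) \<le> - (\<eta> * B) * integral (cbox a b) (\<lambda>x. L (x, s))"
      using mult_left_mono[OF layer[OF \<epsilon>(1,3) s, folded L_def], of "\<eta> * B"] \<eta> B by simp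
    also have "\<dots> = integral (cbox a b) (\<lambda>x. - (\<eta> * B) * L (x, s))"
      by simp
    also have "\<dots> \<le> integral (cbox a b) (\<lambda>x. \<Phi>' (x, s) (0, 1) + (\<Sum>i\<in>UNIV. f' i (x, s) (axis i 1, 0)))"
    proof (rule integral_le)
      show "(\<lambda>x. - (\<eta> * B) * L (x, s)) integrable_on cbox a b"
        by (rule slice[OF _ s]) (intro continuous_intros L_cont)
      show "(\<lambda>x. \<Phi>' (x, s) (0, 1) + (\<Sum>i\<in>UNIV. f' i (x, s) (axis i 1, 0))) integrable_on cbox a b"
        by (rule integrable_add[OF \<Phi>'_int f'_int])
    qed (use pointwise s in \<open>auto simp: K_def\<close>)
    also have "\<dots> = F' s + integral (cbox a b) (\<lambda>x. \<Sum>i\<in>UNIV. f' i (x, s) (axis i 1, 0))"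
      unfolding F'_def by (rule integral_add[OF \<Phi>'_int f'_int])
    also have "integral (cbox a b) (\<lambda>x. \<Sum>i\<in>UNIV. f' i (x, s) (axis i 1, 0)) = 0"
      by (subst integral_sum) (auto simp: f'0 intro!: slice[OF _ s] C1_on_continuous_derivative[OF f])
    finally show ?thesis by simp
  qed
  have "\<exists>s\<in>{t0..t1}. F t1 - F t0 = F' s * (t1 - t0)"
    using F_deriv by (intro mvt_very_simple[OF t]) (auto simp: has_field_derivative_def)
  then obtain s where s: "s \<in> {t0..t1}" "F t1 - F t0 = F' s * (t1 - t0)" by blast
  have "- (\<eta> * B * C) * (t1 - t0) \<le> F' s * (t1 - t0)"
    using F'_lower[OF s(1)] t by (intro mult_right_mono) auto
  then have "F t0 \<le> F t1 + \<eta> * N" using s(2) by (simp add: N_def algebra_simps)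
  then have F_le: "F t0 \<le> F t1 + e" using \<eta> by simp
  \<comment> \<open>Where \<open>\<theta> < 0\<close>, dividing by \<open>\<epsilon> \<le> 1\<close>
    only increases \<open>- \<theta>\<close>, and the cutoff is monotone. This frees the lower bound
    from \<open>\<epsilon>\<close>.\<close>
  have "integral (cbox a b) (\<lambda>x. cutoff (- \<theta> (x, t0)) * \<psi> (x, t0)) \<le> F t0"
    unfolding F_def
  proof (rule integral_le)
    show "(\<lambda>x. cutoff (- \<theta> (x, t0)) * \<psi> (x, t0)) integrable_on cbox a b"
    proof (rule slice)
      show "continuous_on K (\<lambda>p. cutoff (- \<theta> p) * \<psi> p)"
        using C1_on_continuous[OF C1_on_cutoff[OF \<theta>, of 1]] \<psi>_cont by (auto intro!: continuous_intros)
    qed (use t in auto)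
    show "(\<lambda>x. \<Phi> (x, t0)) integrable_on cbox a b"
      using t by (intro slice C1_on_continuous[OF \<Phi>]) auto
    fix x assume x: "x \<in> cbox a b"
    have "cutoff (- \<theta> (x, t0)) \<le> H (x, t0)"
    proof (cases "0 \<le> \<theta> (x, t0)")
      case True
      then show ?thesis using H_nonneg by simp
    next
      case False
      then have "- \<theta> (x, t0) * \<epsilon> \<le> - \<theta> (x, t0) * 1" using \<epsilon> by (intro mult_left_mono) auto
      then have "- \<theta> (x, t0) \<le> - \<theta> (x, t0) / \<epsilon>" using \<epsilon> by (simp add: field_simps)
      then show ?thesis unfolding H_def by (rule cutoff_mono)
    qed
    then show "cutoff (- \<theta> (x, t0)) * \<psi> (x, t0) \<le> \<Phi> (x, t0)"
      using \<psi>_bounds(1)[of "(x, t0)"] x t by (simp add: \<Phi>_def mult_right_mono)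
  qed
  moreover have "F t1 \<le> B * measure lebesgue {x \<in> cbox a b. \<theta> (x, t1) < 0}"
  proof -
    define \<Omega> where "\<Omega> = {x \<in> cbox a b. \<theta> (x, t1) < 0}"
    have "continuous_on (cbox a b) (\<lambda>x. \<theta> (x, t1))"
      using continuous_on_time_slice[OF \<theta>_cont[unfolded K_def]] t by simp
    then have "closed {x \<in> cbox a b. 0 \<le> \<theta> (x, t1)}"
      by (intro continuous_on_closed_Collect_le continuous_intros) auto
    moreover have "\<Omega> = cbox a b - {x \<in> cbox a b. 0 \<le> \<theta> (x, t1)}"
      by (auto simp: \<Omega>_def)
    ultimately have \<Omega>: "\<Omega> \<in> lmeasurable"
      by (simp add: fmeasurable_Diff borel_closed)
    have "(\<lambda>x. if x \<in> cbox a b then indicator \<Omega> x else 0) = (indicator \<Omega> :: _ \<Rightarrow> real)"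
      by (auto simp: \<Omega>_def indicator_def)
    then have "(indicator \<Omega> has_integral measure lebesgue \<Omega>) (cbox a b)"
      using \<Omega> by (subst has_integral_restrict_UNIV[symmetric]) (simp add: lmeasurable_iff_has_integral)
    then have ind: "((\<lambda>x. B * indicator \<Omega> x) has_integral B * measure lebesgue \<Omega>) (cbox a b)"
      by (rule has_integral_mult_right)
    have "F t1 \<le> integral (cbox a b) (\<lambda>x. B * indicator \<Omega> x)"
      unfolding F_def
    proof (rule integral_le)
      show "(\<lambda>x. \<Phi> (x, t1)) integrable_on cbox a b"
        using t by (intro slice C1_on_continuous[OF \<Phi>]) auto
      show "(\<lambda>x. B * indicator \<Omega> x) integrable_on cbox a b" using ind by (rule has_integral_integrable)
      fix x assume x: "x \<in> cbox a b"
      have \<psi>x: "0 \<le> \<psi> (x, t1)" "\<psi> (x, t1) \<le> B" using \<psi>_bounds[of "(x, t1)"] x t by auto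
      show "\<Phi> (x, t1) \<le> B * indicator \<Omega> x"
      proof (cases "x \<in> \<Omega>")
        case True
        have "H (x, t1) * \<psi> (x, t1) \<le> 1 * B"
          using \<psi>x H_nonneg cutoff_le_1 by (intro mult_mono) (auto simp: H_def)
        then show ?thesis using True by (simp add: \<Phi>_def)
      next
        case False
        then have "H (x, t1) = 0" using x \<epsilon> by (simp add: \<Omega>_def H_def)
        then show ?thesis using False by (simp add: \<Phi>_def)
      qed
    qed
    also have "\<dots> = B * measure lebesgue \<Omega>"
      using ind by (rule integral_unique)
    finally show ?thesis by (simp add: \<Omega>_def)
  qed
  ultimately show "integral (cbox a b) (\<lambda>x. cutoff (- \<theta> (x, t0)) * \<psi> (x, t0))
      \<le> B * measure lebesgue {x \<in> cbox a b. \<theta> (x, t1) < 0} + e"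
    using F_le by linarith
qed

section \<open>The maximal speed and the expanding slab\<close>

text \<open>By uniform continuity on the compact product, suprema at nearby times differ by at most
  \<open>e / 2\<close>. Applied to the speed, this makes the integral of \<open>m\<close>
  differentiable in its upper limit.\<close>

lemma continuous_on_SUP_compact:
  fixes f :: "'a::metric_space \<times> 'b::metric_space \<Rightarrow> real"
  assumes A: "compact A" "A \<noteq> {}" and J: "compact J" and f: "continuous_on (A \<times> J) f"
  shows "continuous_on J (\<lambda>s. SUP x\<in>A. f (x, s))"
proof -
  have bdd: "bdd_above ((\<lambda>x. f (x, s)) ` A)" if "s \<in> J" for s
  proof (intro bounded_imp_bdd_above compact_imp_bounded compact_continuous_image A)
    show "continuous_on A (\<lambda>x. f (x, s))" using f that by (rule continuous_on_time_slice)
  qed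
  have unif: "uniformly_continuous_on (A \<times> J) f"
    using compact_uniformly_continuous[OF f] A J by (simp add: compact_Times)
  show ?thesis
    unfolding continuous_on_iff
  proof (intro ballI allI impI)
    fix s and e :: real assume s: "s \<in> J" and e: "0 < e"
    then obtain d where d: "0 < d"
      and close: "\<And>p q. p \<in> A \<times> J \<Longrightarrow> q \<in> A \<times> J \<Longrightarrow> dist q p < d \<Longrightarrow> dist (f q) (f p) < e / 2"
      using unif half_gt_zero[OF e] unfolding uniformly_continuous_on_def by metis
    have le: "(SUP x\<in>A. f (x, r)) \<le> (SUP x\<in>A. f (x, r')) + e / 2"
      if "r \<in> J" "r' \<in> J" "dist r r' < d" for r r'
    proof (rule cSUP_least[OF A(2)])
      fix x assume x: "x \<in> A"
      have "dist (x, r) (x, r') < d" using that by (simp add: dist_Pair_Pair)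
      then have "\<bar>f (x, r) - f (x, r')\<bar> < e / 2"
        using close[of "(x, r')" "(x, r)"] x that by (auto simp: dist_real_def)
      then have "f (x, r) \<le> f (x, r') + e / 2" by linarith
      also have "f (x, r') \<le> (SUP x\<in>A. f (x, r'))" using x bdd that by (intro cSUP_upper) auto
      finally show "f (x, r) \<le> (SUP x\<in>A. f (x, r')) + e / 2" by simp
    qed
    show "\<exists>d>0. \<forall>r\<in>J. dist r s < d \<longrightarrow> dist (SUP x\<in>A. f (x, r)) (SUP x\<in>A. f (x, s)) < e"
    proof (intro exI[of _ d] conjI ballI impI d)
      fix r assume "r \<in> J" "dist r s < d"
      then show "dist (SUP x\<in>A. f (x, r)) (SUP x\<in>A. f (x, s)) < e"
        using le[of r s] le[of s r] s e by (auto simp: dist_real_def dist_commute abs_less_iff)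
    qed
  qed
qed

text \<open>The weight lives on a slab whose faces recede at speed \<open>m\<close>, so that no particle of speed at
  most \<open>m\<close> can leave it.\<close>

lemma expanding_slab_weight:
  fixes R m :: "real \<Rightarrow> real" and k :: "'n::finite" and A :: "(real^'n) set"
  assumes R: "\<And>s. s \<in> {t0..t1} \<Longrightarrow> (R has_real_derivative m s) (at s within {t0..t1})"
    and m: "continuous_on {t0..t1} m"
  obtains \<psi>' where
    "C1_on (A \<times> {t0..t1})
       (\<lambda>p. sqpos (c1 - fst p $ k + R (snd p)) * sqpos (c2 + fst p $ k + R (snd p))) \<psi>'"
    "\<And>p v. p \<in> A \<times> {t0..t1} \<Longrightarrow> \<bar>v k\<bar> \<le> m (snd p) \<Longrightarrow>
       0 \<le> \<psi>' p (0, 1) + (\<Sum>i\<in>UNIV. v i * \<psi>' p (axis i 1, 0))"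
proof -
  let ?S = "A \<times> {t0..t1}"
  have Rsnd: "C1_on ?S (\<lambda>p. R (snd p)) (\<lambda>p v. m (snd p) * snd v)"
    by (rule C1_on_compose[OF C1_on_bounded_linear[OF bounded_linear_snd]])
      (auto intro!: has_field_derivative_subset[OF R] continuous_on_subset[OF m] split: if_splits)
  have lin: "bounded_linear (\<lambda>p::(real^'n) \<times> real. fst p $ k)"
    using bounded_linear_compose[OF bounded_linear_vec_nth bounded_linear_fst] .
  have coord: "C1_on ?S (\<lambda>p. fst p $ k) (\<lambda>p v. fst v $ k)" "C1_on ?S (\<lambda>p. - fst p $ k) (\<lambda>p v. - fst v $ k)"
    using C1_on_bounded_linear[OF lin] C1_on_bounded_linear[OF bounded_linear_minus[OF lin]] by auto
  define z1 where "z1 p = c1 - fst p $ k + R (snd p)" for p :: "(real^'n) \<times> real"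
  define z2 where "z2 p = c2 + fst p $ k + R (snd p)" for p :: "(real^'n) \<times> real"
  have z1: "C1_on ?S z1 (\<lambda>p v. - fst v $ k + m (snd p) * snd v)"
    using C1_on_add[OF C1_on_add[OF C1_on_const[of _ c1] coord(2)] Rsnd] by (simp add: z1_def[abs_def])
  have z2: "C1_on ?S z2 (\<lambda>p v. fst v $ k + m (snd p) * snd v)"
    using C1_on_add[OF C1_on_add[OF C1_on_const[of _ c2] coord(1)] Rsnd] by (simp add: z2_def[abs_def])
  have sq: "C1_on ?S (\<lambda>p. sqpos (z p)) (\<lambda>p v. 2 * max 0 (z p) * z' p v)" if "C1_on ?S z z'" for z z'
    by (rule C1_on_compose[OF that]) (auto intro!: sqpos_deriv continuous_intros)
  define \<psi>' where "\<psi>' p v = sqpos (z1 p) * (2 * max 0 (z2 p) * (fst v $ k + m (snd p) * snd v))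
    + 2 * max 0 (z1 p) * (- fst v $ k + m (snd p) * snd v) * sqpos (z2 p)" for p :: "(real^'n) \<times> real" and v :: "(real^'n) \<times> real"
  show thesis
  proof (rule that[of \<psi>'])
    show "C1_on ?S (\<lambda>p. sqpos (c1 - fst p $ k + R (snd p)) * sqpos (c2 + fst p $ k + R (snd p))) \<psi>'"
      unfolding \<psi>'_def using C1_on_mult[OF sq[OF z1] sq[OF z2]] by (simp add: z1_def z2_def)
    fix p :: "(real^'n) \<times> real" and v :: "'n \<Rightarrow> real"
    assume v: "\<bar>v k\<bar> \<le> m (snd p)"
    \<comment> \<open>The weight depends on position only through coordinate \<open>k\<close>. The
      material derivatives of its two arguments are \<open>m - v k\<close> and
      \<open>m + v k\<close>, both nonnegative by the speed bound.\<close>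
    have "(\<Sum>i\<in>UNIV. v i * \<psi>' p (axis i 1, 0)) = (\<Sum>i\<in>{k}. v i * \<psi>' p (axis i 1, 0))"
      by (rule sum.mono_neutral_right) (auto simp: \<psi>'_def axis_def)
    then have "\<psi>' p (0, 1) + (\<Sum>i\<in>UNIV. v i * \<psi>' p (axis i 1, 0)) =
        sqpos (z1 p) * (2 * max 0 (z2 p)) * (m (snd p) + v k) + 2 * max 0 (z1 p) * sqpos (z2 p) * (m (snd p) - v k)"
      by (simp add: \<psi>'_def algebra_simps)
    also have "\<dots> \<ge> 0"
      by (rule add_nonneg_nonneg; rule mult_nonneg_nonneg) (use v in auto)
    finally show "0 \<le> \<psi>' p (0, 1) + (\<Sum>i\<in>UNIV. v i * \<psi>' p (axis i 1, 0))" .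
  qed
qed

section \<open>Choice of the late time and of the slab, and the uniform volume bound\<close>

theorem mainTheorem1:
  fixes a b :: "real^3" and T :: real
    and \<theta> :: "(real^3) \<times> real \<Rightarrow> real"
    and \<theta>' :: "(real^3) \<times> real \<Rightarrow> (((real^3) \<times> real) \<Rightarrow>\<^sub>L real)"
    and u :: "(real^3) \<times> real \<Rightarrow> real^3"
    and u' :: "(real^3) \<times> real \<Rightarrow> (((real^3) \<times> real) \<Rightarrow>\<^sub>L (real^3))"
  assumes box: "\<forall>i. a$i < b$i"
    and T_pos: "T > 0"
    \<comment> \<open>theta is C^1 on Q \<times> [0,T)\<close>
    and theta_deriv: "\<forall>p \<in> cbox a b \<times> {0..<T}.
                        (\<theta> has_derivative blinfun_apply (\<theta>' p)) (at p within cbox a b \<times> {0..<T})"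
    and theta_C1: "continuous_on (cbox a b \<times> {0..<T}) \<theta>'"
    \<comment> \<open>(i) nonvanishing horizontal gradient on the level set theta = 0\<close>
    and grad: "\<forall>x \<in> cbox a b. \<forall>t \<in> {0..<T}. \<theta> (x, t) = 0 \<longrightarrow>
                 (\<theta>' (x, t) (axis 1 1, 0), \<theta>' (x, t) (axis 2 1, 0)) \<noteq> (0, 0)"
    \<comment> \<open>(ii) nonempty slices\<close>
    and slice_ne: "\<forall>x3 \<in> {a$3..b$3}. \<forall>t \<in> {0..<T}. tube_slice \<theta> a b t x3 \<noteq> {}"
    \<comment> \<open>(iii) closure of slices inside the interior of I1 \<times> I2\<close>
    and slice_int: "\<forall>x3 \<in> {a$3..b$3}. \<forall>t \<in> {0..<T}.
                      closure (tube_slice \<theta> a b t x3) \<subseteq> {a$1<..<b$1} \<times> {a$2<..<b$2}"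
    \<comment> \<open>u is C^1 on Q \<times> [0,T)\<close>
    and u_deriv: "\<forall>p \<in> cbox a b \<times> {0..<T}.
                    (u has_derivative blinfun_apply (u' p)) (at p within cbox a b \<times> {0..<T})"
    and u_C1: "continuous_on (cbox a b \<times> {0..<T}) u'"
    \<comment> \<open>u is divergence free\<close>
    and div_free: "\<forall>p \<in> cbox a b \<times> {0..<T}. (\<Sum>i\<in>UNIV. (u' p (axis i 1, 0)) $ i) = 0"
    \<comment> \<open>the tube moves with u: (d/dt + u \<cdot> grad_x) theta = 0 where theta = 0\<close>
    and moves: "\<forall>x \<in> cbox a b. \<forall>t \<in> {0..<T}. \<theta> (x, t) = 0 \<longrightarrow>
                  \<theta>' (x, t) (0, 1) + (\<Sum>i\<in>UNIV. u (x, t) $ i * \<theta>' (x, t) (axis i 1, 0)) = 0"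
    \<comment> \<open>integral over [0,T) of sup_{x in Q} |u(x,t)| is finite\<close>
    and int_fin: "set_nn_integral lborel {0..<T} (\<lambda>t. ennreal (SUP x\<in>cbox a b. norm (u (x, t)))) < \<infinity>"
  shows "Liminf (at_left T) (\<lambda>t. emeasure lebesgue (tube_set \<theta> (cbox a b) t)) > 0"
proof -
  define Q where "Q = cbox a b"
  have Q_ne: "box a b \<noteq> {}" "Q \<noteq> {}"
    using box by (auto simp: Q_def interval_ne_empty_cart less_imp_le)
  have \<theta>: "C1_on (Q \<times> {0..<T}) \<theta> (\<lambda>p. blinfun_apply (\<theta>' p))"
    using theta_deriv blinfun.continuous_on[OF theta_C1 continuous_on_const] by (auto simp: C1_on_def Q_def)
  have u: "C1_on (Q \<times> {0..<T}) (\<lambda>p. u p $ i) (\<lambda>p v. u' p v $ i)" for i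
    unfolding C1_on_def Q_def
    using u_deriv by (intro conjI ballI allI bounded_linear.has_derivative[OF bounded_linear_vec_nth]
        continuous_on_component blinfun.continuous_on[OF u_C1] continuous_on_const) auto
  have u_cont: "continuous_on (Q \<times> {0..<T}) u"
    using u_deriv by (intro has_derivative_continuous_on) (auto simp: Q_def)
  \<comment> \<open>A point of a lateral face with \<open>\<theta> < 0\<close> would belong to its
    own slice, whose closure lies in the open rectangle by condition (iii).\<close>
  have lateral: "0 \<le> \<theta> (x, s)"
    if x: "x \<in> Q" and s: "s \<in> {0..<T}" and i: "i \<in> {1, 2}" and xi: "x $ i = a $ i \<or> x $ i = b $ i" for x s and i :: 3
  proof (rule ccontr)
    assume neg: "\<not> 0 \<le> \<theta> (x, s)"
    have x_eq: "vector [x $ 1, x $ 2, x $ 3] = x" by (simp add: vec_eq_iff forall_3)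
    have in_Q: "a $ j \<le> x $ j" "x $ j \<le> b $ j" for j using x by (auto simp: Q_def mem_box_cart)
    have "(x $ 1, x $ 2) \<in> tube_slice \<theta> a b s (x $ 3)"
      using neg x in_Q by (simp add: tube_slice_def tube_set_def x_eq Q_def)
    then have "(x $ 1, x $ 2) \<in> closure (tube_slice \<theta> a b s (x $ 3))"
      using closure_subset by blast
    then have "(x $ 1, x $ 2) \<in> {a$1<..<b$1} \<times> {a$2<..<b$2}"
      using slice_int in_Q s by (meson atLeastAtMost_iff subsetD)
    then show False using i xi by auto
  qed

  define m where "m s = (SUP x\<in>Q. norm (u (x, s)))" for s
  \<comment> \<open>The field is given only for times before \<open>T\<close>, so compactness, and
    with it continuity of \<open>m\<close>, is used on closed intervals \<open>{0..s}\<close> with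
    \<open>s < T\<close>.\<close>
  have m_cont: "continuous_on {0..s} m" if "s < T" for s
    unfolding m_def using Q_ne(2) that
    by (intro continuous_on_SUP_compact[where f = "\<lambda>p. norm (u p)"] continuous_on_norm continuous_on_subset[OF u_cont])
      (auto simp: Q_def)
  have u_le_m: "norm (u (x, s)) \<le> m s" if "x \<in> Q" "s \<in> {0..<T}" for x s
    unfolding m_def
  proof (rule cSUP_upper[OF that(1)])
    have "compact ((\<lambda>x. norm (u (x, s))) ` Q)"
      using continuous_on_time_slice[OF u_cont that(2)]
      by (intro compact_continuous_image continuous_on_norm) (auto simp: Q_def)
    then show "bdd_above ((\<lambda>x. norm (u (x, s))) ` Q)"
      by (intro bounded_imp_bdd_above compact_imp_bounded)
  qed
  have m_nonneg: "0 \<le> m s" if "s \<in> {0..<T}" for s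
    using u_le_m[OF _ that] Q_ne(2) norm_ge_zero by (metis ex_in_conv order_trans)
  define R0 where "R0 s = integral {0..s} m" for s
  have m_int: "m integrable_on {0..s}" if "s < T" for s
    using m_cont[OF that] by (rule integrable_continuous_real)
  have R0_mono: "R0 s \<le> R0 s'" if "0 \<le> s" "s \<le> s'" "s' < T" for s s'
    unfolding R0_def using that m_int m_nonneg by (intro integral_subset_le) auto
  define J where "J = set_nn_integral lborel {0..<T} (\<lambda>t. ennreal (m t))"
  have J: "J < \<infinity>" using int_fin by (simp add: J_def m_def Q_def)
  \<comment> \<open>The finite integral dominates every partial integral, so \<open>R0\<close> is
    bounded and \<open>m\<close> is never integrated up to \<open>T\<close> as a real-valued
    integral.\<close>
  have R0_bound: "R0 s \<le> enn2real J" if s: "s \<in> {0..<T}" for s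
  proof -
    have "(\<integral>\<^sup>+x. ennreal (indicator {0..s} x * m x) \<partial>lborel) = ennreal (R0 s)"
      unfolding R0_def using s m_int m_nonneg
      by (intro nn_integral_has_integral_lebesgue integrable_integral) auto
    moreover have "(\<integral>\<^sup>+x. ennreal (indicator {0..s} x * m x) \<partial>lborel) \<le> J"
      unfolding J_def using s by (intro nn_integral_mono) (auto simp: indicator_def)
    ultimately show ?thesis using J
      by (metis enn2real_mono enn2real_ennreal ennreal_neg enn2real_nonneg order_trans linorder_le_cases infinity_ennreal_def)
  qed
  define L where "L = (b $ 3 - a $ 3) / 2"
  define c where "c = (a $ 3 + b $ 3) / 2"
  have L: "0 < L" using box by (simp add: L_def)
  have ab: "a $ 3 = c - L" "b $ 3 = c + L" by (auto simp: c_def L_def field_simps)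
  have R0_bdd: "bdd_above (R0 ` {0..<T})" using R0_bound by (rule bdd_aboveI2)
  \<comment> \<open>\<open>L\<close> is half the height of the box. After \<open>t0\<close> no
    particle can travel farther than \<open>L / 4\<close>, since \<open>R0\<close> is already that
    close to its supremum.\<close>
  obtain t0 where t0: "t0 \<in> {0..<T}" "(SUP s\<in>{0..<T}. R0 s) - L / 4 < R0 t0"
  proof -
    have "(SUP s\<in>{0..<T}. R0 s) - L / 4 < (SUP s\<in>{0..<T}. R0 s)" using L by simp
    then show thesis
      using that T_pos R0_bdd by (subst (asm) less_cSUP_iff) auto
  qed
  define R where "R s = R0 s - R0 t0" for s
  have R_range: "0 \<le> R s" "R s \<le> L / 4" if "s \<in> {t0..<T}" for s
  proof -
    show "0 \<le> R s" using R0_mono[of t0 s] that t0 by (simp add: R_def)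
    have "R0 s \<le> (SUP s\<in>{0..<T}. R0 s)"
      using that t0 R0_bdd by (intro cSUP_upper) auto
    then show "R s \<le> L / 4" using t0 by (simp add: R_def)
  qed
  have R_deriv: "(R has_real_derivative m s) (at s within {t0..t1})" if "s \<in> {t0..t1}" "t1 < T" for s t1
  proof -
    have "(R0 has_real_derivative m s) (at s within {0..t1})"
      unfolding R0_def using that t0 by (intro integral_has_real_derivative m_cont) auto
    then have "(R0 has_real_derivative m s) (at s within {t0..t1})"
      by (rule has_field_derivative_subset) (use t0 in auto)
    then show ?thesis unfolding R_def by (auto intro!: derivative_eq_intros)
  qed
  \<comment> \<open>Positive exactly for \<open>\<bar>x $ 3 - c\<bar> < L / 2 + R s\<close>. As
    \<open>R s \<le> L / 4\<close>, the slab stays within distance \<open>3 * L / 4\<close> of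
    mid-height and never reaches the top or bottom of the box.\<close>
  define \<psi> :: "(real^3) \<times> real \<Rightarrow> real" where
    "\<psi> p = sqpos (L / 2 + c - fst p $ 3 + R (snd p)) * sqpos (L / 2 - c + fst p $ 3 + R (snd p))" for p
  \<comment> \<open>On the box each argument of \<open>sqpos\<close> in \<open>\<psi>\<close> is at
    most \<open>L / 2 + L + L / 4\<close>, hence below \<open>2 * L\<close>.\<close>
  define B where "B = sqpos (2 * L) * sqpos (2 * L)"
  have B: "0 < B" using L by (simp add: B_def)
  have \<psi>_nonneg: "0 \<le> \<psi> p" for p by (simp add: \<psi>_def)
  define \<delta> where "\<delta> = integral Q (\<lambda>x. cutoff (- \<theta> (x, t0)) * \<psi> (x, t0))"

  \<comment> \<open>Neither \<open>\<delta>\<close> nor \<open>B\<close> depends on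
    \<open>t1\<close>, so one bound holds for all times from \<open>t0\<close> up to
    \<open>T\<close>.\<close>
  have volume: "\<delta> \<le> B * measure lebesgue {x \<in> Q. \<theta> (x, t1) < 0}" if t1: "t0 \<le> t1" "t1 < T" for t1
  proof -
    have sub: "Q \<times> {t0..t1} \<subseteq> Q \<times> {0..<T}" using t0 t1 by auto
    have m01: "continuous_on {t0..t1} m"
      by (rule continuous_on_subset[OF m_cont[OF t1(2)]]) (use t0 in auto)
    obtain \<psi>' where \<psi>'_C1: "C1_on (Q \<times> {t0..t1})
        (\<lambda>p. sqpos (L / 2 + c - fst p $ 3 + R (snd p)) * sqpos (L / 2 - c + fst p $ 3 + R (snd p))) \<psi>'"
      and \<psi>'_moves: "\<And>p v. p \<in> Q \<times> {t0..t1} \<Longrightarrow> \<bar>v 3\<bar> \<le> m (snd p) \<Longrightarrow>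
         0 \<le> \<psi>' p (0, 1) + (\<Sum>i\<in>UNIV. v i * \<psi>' p (axis i 1, 0))"
    proof (rule expanding_slab_weight[where A = Q and k = "3::3" and ?c1.0 = "L / 2 + c" and ?c2.0 = "L / 2 - c"])
      show "(R has_real_derivative m s) (at s within {t0..t1})" if "s \<in> {t0..t1}" for s
        using that t1(2) by (rule R_deriv)
    qed (use m01 in blast)+
    have \<psi>_C1: "C1_on (Q \<times> {t0..t1}) \<psi> \<psi>'"
      using \<psi>'_C1 by (simp add: \<psi>_def[abs_def])
    show ?thesis
      unfolding \<delta>_def Q_def
    proof (rule localized_volume_le[where I = "{1, 2}" and u = "\<lambda>i p. u p $ i" and u' = "\<lambda>i p v. u' p v $ i" and \<psi>' = \<psi>',
          OF t1(1) C1_on_subset[OF \<theta> sub, unfolded Q_def] C1_on_subset[OF u sub, unfolded Q_def] \<psi>_C1[unfolded Q_def]])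
      fix p assume p: "p \<in> cbox a b \<times> {t0..t1}"
      then have p': "p \<in> cbox a b \<times> {0..<T}" using sub by (auto simp: Q_def)
      obtain x s where xs: "p = (x, s)" by fastforce
      show "\<exists>i\<in>{1, 2}. \<theta>' p (axis i 1, 0) \<noteq> 0" if "\<theta> p = 0"
        using grad p' that unfolding xs by force
      show "(\<Sum>i\<in>UNIV. u' p (axis i 1, 0) $ i) = 0" using div_free p' by blast
      show "\<theta>' p (0, 1) + (\<Sum>i\<in>UNIV. u p $ i * \<theta>' p (axis i 1, 0)) = 0" if "\<theta> p = 0"
        using moves p' that unfolding xs by blast
      show "0 \<le> \<psi> p" by (rule \<psi>_nonneg)
      have "R s \<le> L / 4" using R_range p t1 by (simp add: xs)
      moreover have "a $ 3 \<le> x $ 3" "x $ 3 \<le> b $ 3" using p by (auto simp: xs mem_box_cart)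
      ultimately show "\<psi> p \<le> B"
        unfolding \<psi>_def B_def xs using L by (intro mult_mono sqpos_mono) (auto simp: ab)
      have "\<bar>u p $ 3\<bar> \<le> m (snd p)"
        using u_le_m[of x s] p' component_le_norm_cart[of "u p" 3] by (simp add: xs Q_def)
      then show "0 \<le> \<psi>' p (0, 1) + (\<Sum>i\<in>UNIV. u p $ i * \<psi>' p (axis i 1, 0))"
        using \<psi>'_moves[of p "\<lambda>i. u p $ i"] p by (simp add: Q_def)
    next
      fix x s and i :: 3 assume x: "x \<in> cbox a b" and s: "s \<in> {t0..t1}" and xi: "x $ i = a $ i \<or> x $ i = b $ i"
      show "0 \<le> \<theta> (x, s)" if "i \<in> {1, 2}"
        using lateral[of x s i] x s t0 t1 that xi by (auto simp: Q_def)
      show "\<psi> (x, s) = 0" if "i \<notin> {1, 2}"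
      proof -
        have "i = 3" using that exhaust_3[of i] by auto
        moreover have "R s \<le> L / 4" using R_range s t1 by simp
        ultimately show ?thesis using xi L by (auto simp: \<psi>_def ab)
      qed
    qed (use B in simp)
  qed

  have "0 < \<delta>"
  proof -
    have "R t0 = 0" by (simp add: R_def)
    \<comment> \<open>Condition (ii) at mid-height gives a point of the tube where both factors of
      \<open>\<psi>\<close> equal \<open>sqpos (L / 2)\<close>, because \<open>R t0 = 0\<close>. A
      continuous nonnegative integrand that is positive at this point cannot have integral
      0.\<close>
    obtain y1 y2 where "(y1, y2) \<in> tube_slice \<theta> a b t0 c"
      using slice_ne t0 L by (force simp: ab)
    then have y: "vector [y1, y2, c] \<in> Q" "\<theta> (vector [y1, y2, c], t0) < 0"
      by (auto simp: tube_slice_def tube_set_def Q_def)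
    let ?g = "\<lambda>x. cutoff (- \<theta> (x, t0)) * \<psi> (x, t0)"
    have "continuous_on Q (\<lambda>x. \<theta> (x, t0))"
      using continuous_on_time_slice[OF C1_on_continuous[OF \<theta>] t0(1)] .
    moreover have "continuous_on UNIV cutoff"
      using cutoff_deriv by (meson DERIV_continuous_on)
    ultimately have cutoff_cont: "continuous_on Q (\<lambda>x. cutoff (- \<theta> (x, t0)))"
      using continuous_on_compose2[OF _ continuous_on_minus] by blast
    have sq: "continuous_on Q (\<lambda>x. sqpos (f x))" if "continuous_on Q f" for f
      using continuous_on_compose2[OF continuous_on_sqpos[of UNIV] that] by simp
    have cont: "continuous_on Q ?g"
      unfolding \<psi>_def fst_conv snd_conv
      by (rule continuous_on_mult[OF cutoff_cont], rule continuous_on_mult; rule sq)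
        (intro continuous_intros)+
    have nonneg: "0 \<le> ?g x" for x using cutoff_nonneg \<psi>_nonneg by simp
    have int: "?g integrable_on Q"
      unfolding Q_def by (rule integrable_continuous[OF cont[unfolded Q_def]])
    have "0 \<le> \<delta>"
      unfolding \<delta>_def by (rule integral_nonneg[OF int nonneg])
    moreover have "\<delta> \<noteq> 0"
    proof
      assume "\<delta> = 0"
      then have "(?g has_integral 0) (cbox a b)"
        using integrable_integral[OF int] by (simp add: \<delta>_def Q_def)
      from has_integral_0_cbox_imp_0[OF cont[unfolded Q_def] nonneg this Q_ne(1) y(1)[unfolded Q_def]]
      show False
        using y(2) cutoff_pos[of "- \<theta> (vector [y1, y2, c], t0)"] L by (auto simp: \<psi>_def \<open>R t0 = 0\<close>)
    qed
    ultimately show ?thesis by simp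
  qed

  have "eventually (\<lambda>t. ennreal (\<delta> / B) \<le> emeasure lebesgue (tube_set \<theta> (cbox a b) t)) (at_left T)"
  proof (rule eventually_at_leftI)
    show "t0 < T" using t0 by simp
    fix t assume "t \<in> {t0<..<T}"
    then have "\<delta> / B \<le> measure lebesgue (tube_set \<theta> (cbox a b) t)"
      using volume[of t] B by (simp add: divide_le_eq mult.commute tube_set_def Q_def)
    then show "ennreal (\<delta> / B) \<le> emeasure lebesgue (tube_set \<theta> (cbox a b) t)"
      by (cases "emeasure lebesgue (tube_set \<theta> (cbox a b) t)") (auto simp: measure_def intro: ennreal_leI)
  qed
  then have "ennreal (\<delta> / B) \<le> Liminf (at_left T) (\<lambda>t. emeasure lebesgue (tube_set \<theta> (cbox a b) t))"
    by (rule Liminf_bounded)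
  moreover have "0 < ennreal (\<delta> / B)" using \<open>0 < \<delta>\<close> B by simp
  ultimately show ?thesis by (rule less_le_trans[rotated])
qed

end
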